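(* Let $\psi\in C([0,T]\times\overline{\mathcal O};\mathbb R)$. If $u,v:[0,T]\times\overline{\mathcal O}\to\mathbb R$ are bounded, $u$ is an usc viscosity subsolution and $v$ is a lsc viscosity supersolution of $\mathrm{VI}_{\min}[\psi]$, then $u\le v$ on $[0,T]\times\overline{\mathcal O}$.
   Context: Standing assumptions: $\mathcal O\subset\mathbb R^d$ bounded open of class $W^{2,\infty}$ with outward unit normal $n$; $\gamma:\mathbb R^d\to\mathbb R^d$ Lipschitz with $\gamma\cdot n\ge c_0>0$ on $\partial\mathcal O$; $b\in C([0,T]\times\overline{\mathcal O};\mathbb R^d)$, $\sigma\in C([0,T]\times\overline{\mathcal O};\mathbb R^{d\times m})$, Lipschitz in space uniformly in time. $H(t,x,p)=\frac12|\sigma(t,x)^Tp|^2-b(t,x)\cdot p$. $\mathrm{VI}_{\min}[\psi]$: $\min(-\partial_tw+H(t,x,Dw),w-\psi)=0$ in $[0,T)\times\mathcal O$, $\partial w/\partial\gamma=0$ on $[0,T)\times\partial\mathcal O$, $w(T)=\psi(T)$ on $\overline{\mathcal O}$. Let $E(t,x,r,q,p)=\min(-q+H(t,x,p),r-\psi(t,x))$ and, for $\varphi\in C^1([0,T]\times\overline{\mathcal O})$, $E_0=E(t_0,x_0,w(t_0,x_0),\partial_t\varphi(t_0,x_0),D\varphi(t_0,x_0))$, $\partial_\gamma\varphi=D\varphi(t_0,x_0)\cdot\gamma(x_0)$. Subsolution (bounded usc $w$): at every local maximum $(t_0,x_0)$ of $w-\varphi$, $E_0\le0$ if $x_0\in\mathcal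 O$ and $\min(E_0,\partial_\gamma\varphi)\le0$ if $x_0\in\partial\mathcal O$ (any $t_0\in[0,T]$). Supersolution (bounded lsc $w$): at every local minimum $(t_0,x_0)$ of $w-\varphi$: $E_0\ge0$ if $t_0<T,x_0\in\mathcal O$; $w(t_0,x_0)-\psi(t_0,x_0)\ge0$ if $t_0=T,x_0\in\mathcal O$; $\max(E_0,\partial_\gamma\varphi)\ge0$ if $t_0<T,x_0\in\partial\mathcal O$; $\max(w(t_0,x_0)-\psi(t_0,x_0),\partial_\gamma\varphi)\ge0$ if $t_0=T,x_0\in\partial\mathcal O$. *)

theory Defs
  imports "HOL-Analysis.Analysis"
begin

text \<open>Bounded open domain of class W^{2,\<infinity>} (= C^{1,1}) with outward unit normal nrm:
  near every boundary point z the domain is the strict sublevel set of a local defining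
  function rho with Lipschitz gradient and nonvanishing gradient at z; the outward unit
  normal at z is grad rho(z) / |grad rho(z)|.\<close>
definition W2inf_domain :: "(real^'n) set \<Rightarrow> (real^'n \<Rightarrow> real^'n) \<Rightarrow> bool" where
  "W2inf_domain Om nrm \<longleftrightarrow> open Om \<and> bounded Om \<and>
     (\<forall>z \<in> frontier Om. \<exists>r>0. \<exists>(rho :: real^'n \<Rightarrow> real) (drho :: real^'n \<Rightarrow> real^'n) L.
        (\<forall>y \<in> ball z r. (rho has_derivative (\<lambda>h. drho y \<bullet> h)) (at y)) \<and>
        L-lipschitz_on (ball z r) drho \<and>
        drho z \<noteq> 0 \<and>
        Om \<inter> ball z r = {y \<in> ball z r. rho y < 0} \<and>
        nrm z = drho z /\<^sub>R norm (drho z))"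

definition Ham :: "(real \<times> (real^'n) \<Rightarrow> real^'m^'n) \<Rightarrow> (real \<times> (real^'n) \<Rightarrow> real^'n)
    \<Rightarrow> real \<Rightarrow> real^'n \<Rightarrow> real^'n \<Rightarrow> real" where
  "Ham \<sigma> b t x p = (1/2) * (norm (transpose (\<sigma> (t,x)) *v p))\<^sup>2 - b (t,x) \<bullet> p"

definition Eop :: "(real \<times> (real^'n) \<Rightarrow> real^'m^'n) \<Rightarrow> (real \<times> (real^'n) \<Rightarrow> real^'n)
    \<Rightarrow> (real \<times> (real^'n) \<Rightarrow> real) \<Rightarrow> real \<Rightarrow> real^'n \<Rightarrow> real \<Rightarrow> real \<Rightarrow> real^'n \<Rightarrow> real" where
  "Eop \<sigma> b \<psi> t x r q p = min (- q + Ham \<sigma> b t x p) (r - \<psi> (t,x))"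

definition test_fun :: "(real \<times> (real^'n) \<Rightarrow> real) \<Rightarrow> (real \<times> (real^'n) \<Rightarrow> real)
    \<Rightarrow> (real \<times> (real^'n) \<Rightarrow> real^'n) \<Rightarrow> bool" where
  "test_fun \<phi> \<phi>t \<phi>x \<longleftrightarrow>
     (\<forall>p. (\<phi> has_derivative (\<lambda>(s,h). \<phi>t p * s + \<phi>x p \<bullet> h)) (at p)) \<and>
     continuous_on UNIV \<phi>t \<and> continuous_on UNIV \<phi>x"

definition local_max_on :: "('a::metric_space) set \<Rightarrow> ('a \<Rightarrow> real) \<Rightarrow> 'a \<Rightarrow> bool" where
  "local_max_on D f p \<longleftrightarrow> p \<in> D \<and> (\<exists>e>0. \<forall>q\<in>D. dist q p < e \<longrightarrow> f q \<le> f p)"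

definition local_min_on :: "('a::metric_space) set \<Rightarrow> ('a \<Rightarrow> real) \<Rightarrow> 'a \<Rightarrow> bool" where
  "local_min_on D f p \<longleftrightarrow> p \<in> D \<and> (\<exists>e>0. \<forall>q\<in>D. dist q p < e \<longrightarrow> f p \<le> f q)"

definition usc_on :: "('a::metric_space) set \<Rightarrow> ('a \<Rightarrow> real) \<Rightarrow> bool" where
  "usc_on D w \<longleftrightarrow> (\<forall>p\<in>D. \<forall>e>0. \<exists>d>0. \<forall>q\<in>D. dist q p < d \<longrightarrow> w q < w p + e)"

definition lsc_on :: "('a::metric_space) set \<Rightarrow> ('a \<Rightarrow> real) \<Rightarrow> bool" where
  "lsc_on D w \<longleftrightarrow> (\<forall>p\<in>D. \<forall>e>0. \<exists>d>0. \<forall>q\<in>D. dist q p < d \<longrightarrow> w p - e < w q)"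

definition cyl :: "real \<Rightarrow> (real^'n) set \<Rightarrow> (real \<times> (real^'n)) set" where
  "cyl T Om = {0..T} \<times> closure Om"

definition visc_sub :: "real \<Rightarrow> (real^'n) set \<Rightarrow> (real^'n \<Rightarrow> real^'n)
    \<Rightarrow> (real \<times> (real^'n) \<Rightarrow> real^'m^'n) \<Rightarrow> (real \<times> (real^'n) \<Rightarrow> real^'n)
    \<Rightarrow> (real \<times> (real^'n) \<Rightarrow> real) \<Rightarrow> (real \<times> (real^'n) \<Rightarrow> real) \<Rightarrow> bool" where
  "visc_sub T Om \<gamma> \<sigma> b \<psi> w \<longleftrightarrow>
     bounded (w ` cyl T Om) \<and> usc_on (cyl T Om) w \<and>
     (\<forall>\<phi> \<phi>t \<phi>x t0 x0. test_fun \<phi> \<phi>t \<phi>x \<and>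
        local_max_on (cyl T Om) (\<lambda>p. w p - \<phi> p) (t0,x0) \<longrightarrow>
        (let E0 = Eop \<sigma> b \<psi> t0 x0 (w (t0,x0)) (\<phi>t (t0,x0)) (\<phi>x (t0,x0));
             g = \<phi>x (t0,x0) \<bullet> \<gamma> x0
         in (x0 \<in> Om \<longrightarrow> E0 \<le> 0) \<and> (x0 \<in> frontier Om \<longrightarrow> min E0 g \<le> 0)))"

definition visc_super :: "real \<Rightarrow> (real^'n) set \<Rightarrow> (real^'n \<Rightarrow> real^'n)
    \<Rightarrow> (real \<times> (real^'n) \<Rightarrow> real^'m^'n) \<Rightarrow> (real \<times> (real^'n) \<Rightarrow> real^'n)
    \<Rightarrow> (real \<times> (real^'n) \<Rightarrow> real) \<Rightarrow> (real \<times> (real^'n) \<Rightarrow> real) \<Rightarrow> bool" where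
  "visc_super T Om \<gamma> \<sigma> b \<psi> w \<longleftrightarrow>
     bounded (w ` cyl T Om) \<and> lsc_on (cyl T Om) w \<and>
     (\<forall>\<phi> \<phi>t \<phi>x t0 x0. test_fun \<phi> \<phi>t \<phi>x \<and>
        local_min_on (cyl T Om) (\<lambda>p. w p - \<phi> p) (t0,x0) \<longrightarrow>
        (let E0 = Eop \<sigma> b \<psi> t0 x0 (w (t0,x0)) (\<phi>t (t0,x0)) (\<phi>x (t0,x0));
             g = \<phi>x (t0,x0) \<bullet> \<gamma> x0
         in (t0 < T \<and> x0 \<in> Om \<longrightarrow> E0 \<ge> 0) \<and>
            (t0 = T \<and> x0 \<in> Om \<longrightarrow> w (t0,x0) - \<psi> (t0,x0) \<ge> 0) \<and>
            (t0 < T \<and> x0 \<in> frontier Om \<longrightarrow> max E0 g \<ge> 0) \<and>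
            (t0 = T \<and> x0 \<in> frontier Om \<longrightarrow> max (w (t0,x0) - \<psi> (t0,x0)) g \<ge> 0)))"

end

theory Submission
  imports Defs
begin

text \<open>
  Doubling of variables for \<open>\<mu> u - v - \<kappa> (T - t)\<close> with \<open>\<mu> < 1\<close> close to \<open>1\<close>. The quadratic growth
  of the Hamiltonian would spoil the usual estimate, since \<open>|x - y| |p|\<^sup>2\<close> need not vanish for
  \<open>p \<sim> (x - y)/\<epsilon>\<close>; but the factor \<open>1/\<mu>\<close> leaves a surplus of \<open>|\<sigma>\<^sup>T p|\<^sup>2\<close> which absorbs this term.

  For the oblique boundary condition the penalty is \<open>A(z)(x - y)\<cdot>(x - y)/\<epsilon>\<close> with \<open>A(z)\<close> symmetric, positive
  definite, Lipschitz in \<open>z\<close>, and such that \<open>A(x) \<gamma>(x)\<close> is a positive multiple of the outer normal at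
  boundary points, so that \<open>A(x)(x - y)\<cdot>\<gamma>(x) \<ge> -C |x - y|\<^sup>2\<close>. Since \<open>A\<close> is only Lipschitz, it may not
  depend on \<open>x\<close> or \<open>y\<close> in a test function of class \<open>C\<^sup>1\<close>; instead one also maximises over \<open>z\<close>, with the extra
  penalty \<open>|x - z|\<^sup>2/\<epsilon>\<close>, and maximality in \<open>z\<close> gives \<open>|x - z| \<le> C |x - y|\<^sup>2\<close>.

  A small linear term \<open>\<delta> l\<cdot>x + \<delta> l\<cdot>y\<close> makes the boundary inequalities strict. It moves the maximum by
  \<open>O(\<delta>)\<close>, but as the localisation at the unperturbed maximum \<open>a\<close> uses the same quadratic form \<open>A(a)\<close>,
  its effect on the oblique derivative is only \<open>O(\<delta>\<^sup>2)\<close>.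
\<close>

section \<open>Semicontinuous functions and test functions\<close>

text \<open>If no point were a maximiser, every \<open>p\<close> would have some \<open>m p\<close>
  with a larger value, and semicontinuity would keep \<open>f\<close> below \<open>f (m p)\<close>
  near \<open>p\<close>. In a finite subcover take the centre with the largest
  \<open>f (m p)\<close>: the point \<open>m p\<close> itself lies in one of the neighbourhoods, so
  its value is strictly below that maximum.\<close>

lemma usc_attains_max:
  assumes "compact D" "D \<noteq> {}" and usc: "usc_on D f"
  obtains p where "p \<in> D" "\<And>q. q \<in> D \<Longrightarrow> f q \<le> f p"
proof (rule ccontr)
  assume "\<not> thesis"
  then have "\<forall>p\<in>D. \<exists>q\<in>D. f p < f q"
    using that by (meson linorder_not_le)
  then obtain m where m: "\<And>p. p \<in> D \<Longrightarrow> m p \<in> D \<and> f p < f (m p)"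
    by metis
  have "\<forall>p\<in>D. \<exists>d>0. \<forall>q\<in>D. dist q p < d \<longrightarrow> f q < f (m p)"
  proof
    fix p assume "p \<in> D"
    moreover from this have "0 < f (m p) - f p" using m by simp
    ultimately obtain d where "d > 0" "\<forall>q\<in>D. dist q p < d \<longrightarrow> f q < f p + (f (m p) - f p)"
      using usc unfolding usc_on_def by blast
    then show "\<exists>d>0. \<forall>q\<in>D. dist q p < d \<longrightarrow> f q < f (m p)" by auto
  qed
  then obtain d where d: "\<And>p. p \<in> D \<Longrightarrow> d p > 0"
    "\<And>p q. p \<in> D \<Longrightarrow> q \<in> D \<Longrightarrow> dist q p < d p \<Longrightarrow> f q < f (m p)"
    by metis
  have "D \<subseteq> (\<Union>p\<in>D. ball p (d p))" using d(1) by force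
  then obtain S where S: "S \<subseteq> D" "finite S" "D \<subseteq> (\<Union>p\<in>S. ball p (d p))"
    using compactE_image[OF \<open>compact D\<close>, of D "\<lambda>p. ball p (d p)"] by auto
  then have "S \<noteq> {}" using \<open>D \<noteq> {}\<close> by auto
  let ?V = "(\<lambda>q. f (m q)) ` S"
  have V: "finite ?V" "?V \<noteq> {}" using S(2) \<open>S \<noteq> {}\<close> by auto
  obtain p where p: "p \<in> S" "f (m p) = Max ?V" using Max_in[OF V] by auto
  have pmax: "f (m q) \<le> f (m p)" if "q \<in> S" for q
    unfolding p(2) using V(1) that by (intro Max_ge) auto
  have "m p \<in> D" using m p(1) S(1) by blast
  with S(3) obtain q where q: "q \<in> S" "m p \<in> ball q (d q)" by blast
  then have "f (m p) < f (m q)"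
    using d(2)[of q "m p"] S(1) \<open>m p \<in> D\<close> by (auto simp: dist_commute)
  with pmax[OF q(1)] show False by simp
qed

text \<open>Around each point both functions exceed their central values by at most
  \<open>\<eta>/2\<close>, and a Lebesgue number puts \<open>p\<close> and \<open>q\<close> into one
  such neighbourhood. In the doubling argument this limits what can be gained by evaluating
  \<open>U\<close> and \<open>W\<close> at different points.\<close>

lemma usc_near_diagonal:
  assumes "compact D" and f: "usc_on D f" and g: "usc_on D g"
    and le: "\<And>p. p \<in> D \<Longrightarrow> f p + g p \<le> M" and "\<eta> > 0"
  obtains d where "d > 0" "\<And>p q. \<lbrakk>p \<in> D; q \<in> D; dist p q < d\<rbrakk> \<Longrightarrow> f p + g q \<le> M + \<eta>"
proof -
  have "\<forall>p\<in>D. \<exists>d>0. \<forall>q\<in>D. dist q p < d \<longrightarrow> f q < f p + \<eta>/2 \<and> g q < g p + \<eta>/2"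
  proof
    fix p assume "p \<in> D"
    moreover have "\<eta>/2 > 0" using \<open>\<eta> > 0\<close> by simp
    ultimately obtain d1 d2 where "d1 > 0" "\<forall>q\<in>D. dist q p < d1 \<longrightarrow> f q < f p + \<eta>/2"
      "d2 > 0" "\<forall>q\<in>D. dist q p < d2 \<longrightarrow> g q < g p + \<eta>/2"
      using f g unfolding usc_on_def by metis
    then show "\<exists>d>0. \<forall>q\<in>D. dist q p < d \<longrightarrow> f q < f p + \<eta>/2 \<and> g q < g p + \<eta>/2"
      by (intro exI[of _ "min d1 d2"]) auto
  qed
  then obtain d where d: "\<And>p. p \<in> D \<Longrightarrow> d p > 0"
    "\<And>p q. p \<in> D \<Longrightarrow> q \<in> D \<Longrightarrow> dist q p < d p \<Longrightarrow> f q < f p + \<eta>/2 \<and> g q < g p + \<eta>/2"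
    by metis
  have "D \<subseteq> \<Union>((\<lambda>p. ball p (d p)) ` D)" using d(1) by force
  then obtain e where e: "e > 0" "\<And>x. x \<in> D \<Longrightarrow> \<exists>G\<in>(\<lambda>p. ball p (d p)) ` D. ball x e \<subseteq> G"
    using Heine_Borel_lemma[OF \<open>compact D\<close>, of "(\<lambda>p. ball p (d p)) ` D"] by (metis (no_types, lifting) imageE open_ball)
  show thesis
  proof (rule that[OF e(1)])
    fix p q assume pq: "p \<in> D" "q \<in> D" "dist p q < e"
    then obtain w where w: "w \<in> D" "ball p e \<subseteq> ball w (d w)" using e(2) by blast
    then have "p \<in> ball w (d w)" "q \<in> ball w (d w)" using pq e(1) by (auto simp: subset_iff)
    then have "f p < f w + \<eta>/2" "g q < g w + \<eta>/2" using d(2)[OF w(1)] pq by (auto simp: dist_commute)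
    then show "f p + g q \<le> M + \<eta>" using le[OF w(1)] by linarith
  qed
qed

section \<open>Operations that preserve upper semicontinuity\<close>

lemma usc_on_add:
  assumes "usc_on D f" "usc_on D g"
  shows "usc_on D (\<lambda>p. f p + g p)"
  unfolding usc_on_def
proof (intro ballI allI impI)
  fix p and e :: real assume "p \<in> D" "e > 0"
  moreover have "e/2 > 0" using \<open>e > 0\<close> by simp
  ultimately obtain d1 d2 where "d1 > 0" "\<forall>q\<in>D. dist q p < d1 \<longrightarrow> f q < f p + e/2"
    "d2 > 0" "\<forall>q\<in>D. dist q p < d2 \<longrightarrow> g q < g p + e/2"
    using assms unfolding usc_on_def by metis
  then show "\<exists>d>0. \<forall>q\<in>D. dist q p < d \<longrightarrow> f q + g q < f p + g p + e"
    by (intro exI[of _ "min d1 d2"]) fastforce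
qed

lemma usc_on_continuous:
  assumes "continuous_on D f"
  shows "usc_on D f"
  unfolding usc_on_def
proof (intro ballI allI impI)
  fix p and e :: real assume "p \<in> D" "e > 0"
  then obtain d where "d > 0" "\<forall>q\<in>D. dist q p < d \<longrightarrow> dist (f q) (f p) < e"
    using assms unfolding continuous_on_iff by metis
  then show "\<exists>d>0. \<forall>q\<in>D. dist q p < d \<longrightarrow> f q < f p + e"
    by (intro exI[of _ d]) (auto simp: dist_real_def abs_less_iff)
qed

lemma usc_on_compose:
  assumes "usc_on E f" "continuous_on D g" "g ` D \<subseteq> E"
  shows "usc_on D (\<lambda>p. f (g p))"
  unfolding usc_on_def
proof (intro ballI allI impI)
  fix p and e :: real assume "p \<in> D" "e > 0"
  moreover have "g p \<in> E" using assms(3) \<open>p \<in> D\<close> by auto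
  ultimately obtain d' where d': "d' > 0" "\<forall>q\<in>E. dist q (g p) < d' \<longrightarrow> f q < f (g p) + e"
    using assms(1) unfolding usc_on_def by metis
  then obtain d where "d > 0" "\<forall>q\<in>D. dist q p < d \<longrightarrow> dist (g q) (g p) < d'"
    using assms(2) \<open>p \<in> D\<close> unfolding continuous_on_iff by metis
  then show "\<exists>d>0. \<forall>q\<in>D. dist q p < d \<longrightarrow> f (g q) < f (g p) + e"
    using d' assms(3) by (intro exI[of _ d]) auto
qed

lemma usc_on_cmult:
  assumes "usc_on D f" "0 < (c::real)"
  shows "usc_on D (\<lambda>p. c * f p)"
  unfolding usc_on_def
proof (intro ballI allI impI)
  fix p and e :: real assume "p \<in> D" "e > 0"
  moreover have "e/c > 0" using \<open>e > 0\<close> assms(2) by simp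
  ultimately obtain d where d: "d > 0" "\<forall>q\<in>D. dist q p < d \<longrightarrow> f q < f p + e/c"
    using assms(1) unfolding usc_on_def by metis
  have "c * f q < c * f p + e" if "f q < f p + e/c" for q
    using mult_strict_left_mono[OF that assms(2)] assms(2) by (simp add: distrib_left)
  with d show "\<exists>d>0. \<forall>q\<in>D. dist q p < d \<longrightarrow> c * f q < c * f p + e" by blast
qed

lemma usc_on_uminus_lsc:
  assumes "lsc_on D f"
  shows "usc_on D (\<lambda>p. - f p)"
  unfolding usc_on_def
proof (intro ballI allI impI)
  fix p and e :: real assume "p \<in> D" "e > 0"
  then obtain d where "d > 0" "\<forall>q\<in>D. dist q p < d \<longrightarrow> f p - e < f q"
    using assms unfolding lsc_on_def by metis
  then show "\<exists>d>0. \<forall>q\<in>D. dist q p < d \<longrightarrow> - f q < - f p + e"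
    by (intro exI[of _ d]) auto
qed

section \<open>Calculus of test functions\<close>

lemma test_funI:
  assumes "\<And>p. (f has_derivative (\<lambda>k. ft p * fst k + fx p \<bullet> snd k)) (at p)"
    and "continuous_on UNIV ft" "continuous_on UNIV fx"
  shows "test_fun f ft fx"
  using assms by (simp add: test_fun_def case_prod_unfold)

lemma test_funD:
  assumes "test_fun f ft fx"
  shows "(f has_derivative (\<lambda>k. ft p * fst k + fx p \<bullet> snd k)) (at p)"
    and "continuous_on UNIV ft" "continuous_on UNIV fx"
  using assms by (auto simp: test_fun_def case_prod_unfold simp del: split_paired_All)

lemma test_fun_add:
  assumes "test_fun f ft fx" "test_fun g gt gx"
  shows "test_fun (\<lambda>p. f p + g p) (\<lambda>p. ft p + gt p) (\<lambda>p. fx p + gx p)"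
proof (rule test_funI)
  show "((\<lambda>p. f p + g p) has_derivative (\<lambda>k. (ft p + gt p) * fst k + (fx p + gx p) \<bullet> snd k)) (at p)" for p
    by (rule has_derivative_eq_rhs[OF has_derivative_add[OF test_funD(1)[OF assms(1)] test_funD(1)[OF assms(2)]]])
      (simp add: fun_eq_iff algebra_simps)
qed (intro continuous_on_add test_funD[OF assms(1)] test_funD[OF assms(2)])+

lemma test_fun_scale:
  assumes "test_fun f ft fx"
  shows "test_fun (\<lambda>p. c * f p) (\<lambda>p. c * ft p) (\<lambda>p. c *\<^sub>R fx p)"
proof (rule test_funI)
  show "((\<lambda>p. c * f p) has_derivative (\<lambda>k. (c * ft p) * fst k + (c *\<^sub>R fx p) \<bullet> snd k)) (at p)" for p
    by (rule has_derivative_eq_rhs[OF has_derivative_mult_right[OF test_funD(1)[OF assms]]])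
      (simp add: fun_eq_iff algebra_simps)
qed (intro continuous_intros test_funD[OF assms])+

lemma test_fun_quadratic:
  assumes "linear q" and sym: "\<And>h k. q h \<bullet> k = h \<bullet> q k"
  shows "test_fun (\<lambda>p. q (snd p - a) \<bullet> (snd p - a)) (\<lambda>p. 0) (\<lambda>p. 2 *\<^sub>R q (snd p - a))"
proof (rule test_funI)
  have bl: "bounded_linear q" using assms(1) by (simp add: linear_conv_bounded_linear)
  have d: "((\<lambda>p. snd p - a) has_derivative snd) (at p)" for p :: "real \<times> (real^'a)"
    by (auto intro!: derivative_eq_intros)
  show "((\<lambda>p. q (snd p - a) \<bullet> (snd p - a)) has_derivative
      (\<lambda>k. 0 * fst k + (2 *\<^sub>R q (snd p - a)) \<bullet> snd k)) (at p)" for p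
    by (rule has_derivative_eq_rhs[OF has_derivative_inner[OF bounded_linear.has_derivative[OF bl d] d]])
      (simp add: fun_eq_iff sym inner_commute)
  show "continuous_on UNIV (\<lambda>p. 2 *\<^sub>R q (snd p - a))"
    by (intro continuous_intros bounded_linear.continuous_on[OF bl])
qed simp

lemma test_fun_time_quadratic: "test_fun (\<lambda>p. (fst p - a)\<^sup>2) (\<lambda>p. 2 * (fst p - a)) (\<lambda>p. 0)"
  by (rule test_funI) (auto intro!: continuous_intros derivative_eq_intros)

lemma test_fun_time_linear: "test_fun (\<lambda>p. a - fst p) (\<lambda>p. -1) (\<lambda>p. 0)"
  by (rule test_funI) (auto intro!: continuous_intros derivative_eq_intros)

lemma test_fun_linear: "test_fun (\<lambda>p. l \<bullet> (snd p - a)) (\<lambda>p. 0) (\<lambda>p. l)"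
  by (rule test_funI) (auto intro!: continuous_intros derivative_eq_intros)

section \<open>Quadratic forms adapted to the oblique direction\<close>

text \<open>Here \<open>q z\<close> is the matrix \<open>A(z)\<close> near the point \<open>a\<close>, and \<open>l\<close> is a fixed vector that points outwards
  along \<open>\<gamma>\<close>. At interior points \<open>q z\<close> is the identity and \<open>l = 0\<close>.\<close>
definition oblique_frame ::
  "(real^'n) set \<Rightarrow> (real^'n \<Rightarrow> real^'n) \<Rightarrow> real^'n \<Rightarrow> real \<Rightarrow> real \<Rightarrow> real
    \<Rightarrow> (real^'n \<Rightarrow> real^'n \<Rightarrow> real^'n) \<Rightarrow> real^'n \<Rightarrow> bool" where
  "oblique_frame Om \<gamma> a r c C q l \<longleftrightarrow>
     0 < r \<and> 0 < c \<and> 1 \<le> C \<and> norm l \<le> C \<and>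
     continuous_on ((closure Om \<inter> cball a r) \<times> UNIV) (\<lambda>p. q (fst p) (snd p)) \<and>
     (\<forall>z \<in> closure Om \<inter> cball a r.
        linear (q z) \<and> norm (\<gamma> z) \<le> C \<and> (\<forall>h k. q z h \<bullet> k = h \<bullet> q z k) \<and>
        (\<forall>h. c * (norm h)\<^sup>2 \<le> q z h \<bullet> h \<and> norm (q z h) \<le> C * norm h) \<and>
        (\<forall>w \<in> closure Om \<inter> cball a r. \<forall>h. norm (q z h - q w h) \<le> C * norm (z - w) * norm h)) \<and>
     (\<forall>x \<in> frontier Om \<inter> cball a r.
        c \<le> l \<bullet> \<gamma> x \<and>
        (\<forall>y \<in> closure Om \<inter> cball a r. - C * (norm (x - y))\<^sup>2 \<le> q x (x - y) \<bullet> \<gamma> x))"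

section \<open>Construction of the frame at interior and boundary points\<close>

text \<open>A closed ball inside the open set contains no boundary point, so the oblique clauses are
  vacuous and the identity matrix suffices; the constant only has to dominate
  \<open>\<gamma>\<close> on the ball.\<close>

lemma oblique_frame_interior:
  fixes Om :: "(real^'n) set"
  assumes "open Om" "a \<in> Om" "continuous_on UNIV \<gamma>"
  obtains r c C q l where "oblique_frame Om \<gamma> a r c C q l"
proof -
  obtain r where r: "r > 0" "cball a r \<subseteq> Om"
    using assms open_contains_cball by blast
  have "compact (\<gamma> ` cball a r)"
    using assms(3) by (intro compact_continuous_image continuous_on_subset[OF assms(3)]) auto
  then obtain G where G: "\<And>x. x \<in> cball a r \<Longrightarrow> norm (\<gamma> x) \<le> G"
    by (meson bounded_iff compact_imp_bounded image_eqI)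
  have C: "norm (\<gamma> x) \<le> 1 + \<bar>G\<bar>" if "x \<in> cball a r" for x using G[OF that] by linarith
  have h: "norm h \<le> (1 + \<bar>G\<bar>) * norm h" for h :: "real^'n" by (simp add: mult_le_cancel_right1)
  have "frontier Om \<inter> cball a r = {}"
    using r(2) assms(1) by (auto simp: frontier_def interior_open)
  then have "oblique_frame Om \<gamma> a r 1 (1 + \<bar>G\<bar>) (\<lambda>z h. h) 0"
    unfolding oblique_frame_def
    using r(1) C h by (auto intro!: continuous_intros linear_id[unfolded id_def]
        simp: power2_norm_eq_inner)
  then show thesis by (rule that)
qed

text \<open>The boundary matrix is built from rank-one maps. Changing one factor at a time gives
  their Lipschitz dependence on the base point.\<close>

lemma norm_inner_scaleR_diff_le:
  fixes a a' b b' h :: "'a::real_inner"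
  shows "norm ((a \<bullet> h) *\<^sub>R b - (a' \<bullet> h) *\<^sub>R b') \<le> (norm (a - a') * norm b + norm a' * norm (b - b')) * norm h"
proof -
  have "(a \<bullet> h) *\<^sub>R b - (a' \<bullet> h) *\<^sub>R b' = ((a - a') \<bullet> h) *\<^sub>R b + (a' \<bullet> h) *\<^sub>R (b - b')"
    by (simp add: algebra_simps)
  also have "norm \<dots> \<le> norm (a - a') * norm h * norm b + norm a' * norm h * norm (b - b')"
    by (rule norm_triangle_le) (auto intro!: add_mono mult_right_mono Cauchy_Schwarz_ineq2)
  finally show ?thesis by (simp add: algebra_simps)
qed

text \<open>A quotient estimate with denominators bounded away from zero, for the gradient of the
  defining function divided by its pairing with \<open>\<gamma>\<close>.\<close>

lemma norm_inverse_scaleR_diff_le: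
  fixes a b :: "'a::real_normed_vector" and s t c :: real
  assumes "0 < c" "c \<le> s" "c \<le> t"
  shows "norm (a /\<^sub>R s - b /\<^sub>R t) \<le> norm (a - b) / c + norm b * \<bar>s - t\<bar> / c\<^sup>2"
proof -
  have pos: "s > 0" "t > 0" using assms by auto
  have "a /\<^sub>R s - b /\<^sub>R t = (a - b) /\<^sub>R s + ((t - s) / (s * t)) *\<^sub>R b"
  proof -
    have *: "(t - s) / (s * t) = inverse s - inverse t" using pos by (simp add: field_simps)
    show ?thesis unfolding *
      by (simp add: scaleR_diff_left scaleR_diff_right)
  qed
  also have "norm \<dots> \<le> norm (a - b) / s + \<bar>s - t\<bar> / (s * t) * norm b"
    using pos by (intro norm_triangle_le) (simp add: abs_minus_commute abs_mult divide_simps)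
  also have "\<dots> \<le> norm (a - b) / c + \<bar>s - t\<bar> / c\<^sup>2 * norm b"
  proof (intro add_mono mult_right_mono)
    show "norm (a - b) / s \<le> norm (a - b) / c" using assms by (intro divide_left_mono) auto
    have "c\<^sup>2 \<le> s * t" unfolding power2_eq_square using assms by (intro mult_mono) auto
    then show "\<bar>s - t\<bar> / (s * t) \<le> \<bar>s - t\<bar> / c\<^sup>2" using assms pos by (intro divide_left_mono) auto
  qed auto
  finally show ?thesis by (simp add: algebra_simps)
qed

text \<open>The defining function is nonnegative at \<open>x\<close>, which lies outside the open
  domain, and nonpositive at \<open>y\<close> in the closure. A Lipschitz gradient makes the
  first-order expansion at \<open>x\<close> exact up to a quadratic error, so the linear term has
  the stated sign up to that error.\<close>

lemma defining_function_oblique_bound: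
  fixes Om :: "(real^'n) set" and rho :: "real^'n \<Rightarrow> real"
  assumes "open Om"
    and der: "\<And>y. y \<in> ball a r \<Longrightarrow> (rho has_derivative (\<lambda>h. drho y \<bullet> h)) (at y)"
    and lip: "L-lipschitz_on (ball a r) drho"
    and sub: "Om \<inter> ball a r = {y \<in> ball a r. rho y < 0}"
    and x: "x \<in> frontier Om \<inter> ball a r" and y: "y \<in> closure Om \<inter> ball a r"
  shows "- L * (norm (x - y))\<^sup>2 \<le> drho x \<bullet> (x - y)"
proof -
  have "x \<notin> Om" using x assms(1) by (auto simp: frontier_def interior_open)
  then have "0 \<le> rho x" using sub x by fastforce
  have "rho y \<le> 0"
  \<comment> \<open>If \<open>rho\<close> were positive at \<open>y\<close>, it would be positive on
    a neighbourhood, and this neighbourhood meets \<open>Om\<close>, where \<open>rho\<close> is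
    negative.\<close>
  proof (rule ccontr)
    assume "\<not> rho y \<le> 0"
    have "continuous (at y) rho" using der[of y] y has_derivative_continuous by blast
    then have "\<forall>\<^sub>F w in nhds y. 0 < rho w"
      using \<open>\<not> rho y \<le> 0\<close> by (auto simp: isCont_def tendsto_at_iff_tendsto_nhds intro: order_tendstoD(1))
    moreover have "\<forall>\<^sub>F w in nhds y. w \<in> ball a r" using y by (intro eventually_nhds_in_open) auto
    ultimately have "\<forall>\<^sub>F w in nhds y. 0 < rho w \<and> w \<in> ball a r" by eventually_elim simp
    then obtain S where S: "open S" "y \<in> S" "\<And>w. w \<in> S \<Longrightarrow> 0 < rho w \<and> w \<in> ball a r"
      unfolding eventually_nhds by blast
    then obtain w where "w \<in> Om" "w \<in> S" using y by (metis IntD1 closure_iff_nhds_not_empty disjoint_iff subset_refl inf_commute)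
    with S(3)[of w] have "w \<in> Om \<inter> ball a r" "0 < rho w" by auto
    then show False unfolding sub by simp
  qed
  have seg: "closed_segment x y \<subseteq> ball a r"
    using x y by (intro closed_segment_subset) auto
  have Lnn: "0 \<le> L" using lip by (rule lipschitz_on_nonneg)
  \<comment> \<open>The mean value inequality is applied on the segment from \<open>x\<close> to
    \<open>y\<close>, which stays in the ball by convexity; there the gradient differs from
    \<open>drho x\<close> by at most \<open>L * norm (y - x)\<close>.\<close>
  have "norm (rho y - rho x - drho x \<bullet> (y - x)) \<le> norm (y - x) * (L * norm (y - x))"
  proof (rule differentiable_bound_linearization[where S = "closed_segment x y" and f' = "\<lambda>w h. drho w \<bullet> h"])
    show "x + t *\<^sub>R (y - x) \<in> closed_segment x y" if "t \<in> {0..1}" for t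
      using that unfolding closed_segment_def mem_Collect_eq
      by (intro exI[of _ t]) (auto simp: algebra_simps)
    show "(rho has_derivative (\<bullet>) (drho w)) (at w within closed_segment x y)" if "w \<in> closed_segment x y" for w
      using der[of w] that seg has_derivative_at_withinI by blast
    show "onorm ((\<bullet>) (drho w) - (\<bullet>) (drho x)) \<le> L * norm (y - x)" if w: "w \<in> closed_segment x y" for w
    proof (rule onorm_le)
      fix h
      have "norm (drho w - drho x) \<le> L * norm (w - x)"
        using lipschitz_onD[OF lip, of w x] w seg x by (auto simp: dist_norm)
      also have "\<dots> \<le> L * norm (y - x)"
        using segment_bound[OF w] Lnn by (intro mult_left_mono) auto
      finally have "norm (drho w - drho x) \<le> L * norm (y - x)" .
      then show "norm (((\<bullet>) (drho w) - (\<bullet>) (drho x)) h) \<le> L * norm (y - x) * norm h"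
        unfolding fun_diff_def inner_diff_left[symmetric] real_norm_def
        by (meson Cauchy_Schwarz_ineq2 mult_right_mono norm_ge_zero order_trans)
    qed
  qed simp
  then have "drho x \<bullet> (y - x) \<le> rho y - rho x + L * (norm (x - y))\<^sup>2"
    by (simp add: power2_eq_square abs_le_iff norm_minus_commute algebra_simps)
  then have "drho x \<bullet> (y - x) \<le> L * (norm (x - y))\<^sup>2"
    using \<open>0 \<le> rho x\<close> \<open>rho y \<le> 0\<close> by linarith
  then show ?thesis by (simp add: inner_diff_right)
qed


text \<open>With \<open>m \<cdot> \<gamma> = 1\<close> and \<open>m\<close> normal to the boundary, the form below is
  \<open>|h - (m \<cdot> h) \<gamma>|\<^sup>2 + (k - |\<gamma>|\<^sup>2) (m \<cdot> h)\<^sup>2\<close>, and its matrix maps \<open>\<gamma>\<close> to \<open>(k - |\<gamma>|\<^sup>2) m\<close>.\<close>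
lemma oblique_frame_boundary:
  fixes Om :: "(real^'n) set" and rho :: "real^'n \<Rightarrow> real"
  assumes "open Om" and a: "a \<in> frontier Om" and "0 < r0"
    and der: "\<And>y. y \<in> ball a r0 \<Longrightarrow> (rho has_derivative (\<lambda>h. drho y \<bullet> h)) (at y)"
    and lip: "L-lipschitz_on (ball a r0) drho"
    and sub: "Om \<inter> ball a r0 = {y \<in> ball a r0. rho y < 0}"
    and glip: "Lg-lipschitz_on UNIV \<gamma>" and obl: "0 < drho a \<bullet> \<gamma> a"
  obtains r c C q l where "oblique_frame Om \<gamma> a r c C q l"
proof -
  \<comment> \<open>Obliqueness is an open condition: \<open>g\<close> and the pairing of the fixed
    vector \<open>drho a\<close> with \<open>\<gamma>\<close> agree at \<open>a\<close>, and both
    exceed half of that value on a small ball. The first bound permits the normalisation of the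
    gradient, the second makes \<open>drho a\<close> a valid choice for \<open>l\<close>.\<close>
  define g where "g = (\<lambda>w. drho w \<bullet> \<gamma> w)"
  define c1 where "c1 = g a / 2"
  have c1: "0 < c1" "c1 < g a" using obl by (auto simp: c1_def g_def)
  have cont: "continuous_on (ball a r0) drho" "continuous_on (ball a r0) \<gamma>"
    using lipschitz_on_continuous_on[OF lip] lipschitz_on_continuous_on[OF glip]
    by (auto intro: continuous_on_subset)
  have "continuous_on (ball a r0) g" "continuous_on (ball a r0) (\<lambda>w. drho a \<bullet> \<gamma> w)"
    unfolding g_def by (intro continuous_intros cont)+
  then have "isCont g a" "isCont (\<lambda>w. drho a \<bullet> \<gamma> w) a"
    using \<open>0 < r0\<close> by (auto simp: continuous_on_eq_continuous_at)
  then have "(g \<longlongrightarrow> g a) (nhds a)" "((\<lambda>w. drho a \<bullet> \<gamma> w) \<longlongrightarrow> g a) (nhds a)"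
    using tendsto_at_iff_tendsto_nhds[of g a] tendsto_at_iff_tendsto_nhds[of "\<lambda>w. drho a \<bullet> \<gamma> w" a]
    by (simp_all add: isCont_def g_def)
  then have "\<forall>\<^sub>F w in nhds a. c1 < g w" "\<forall>\<^sub>F w in nhds a. c1 < drho a \<bullet> \<gamma> w"
    using order_tendstoD(1) c1(2) by blast+
  then have "\<forall>\<^sub>F w in nhds a. c1 < g w \<and> c1 < drho a \<bullet> \<gamma> w" by eventually_elim simp
  then obtain r1 where r1: "r1 > 0" "\<And>w. dist w a < r1 \<Longrightarrow> c1 < g w \<and> c1 < drho a \<bullet> \<gamma> w"
    unfolding eventually_nhds_metric by blast
  define r where "r = min r0 r1 / 2"
  have r: "0 < r" "cball a r \<subseteq> ball a r0" "\<And>w. w \<in> cball a r \<Longrightarrow> c1 \<le> g w \<and> c1 \<le> drho a \<bullet> \<gamma> w"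
    using r1 \<open>0 < r0\<close> by (auto simp: r_def dist_commute intro: less_imp_le)
  have "bounded (drho ` cball a r)" "bounded (\<gamma> ` cball a r)"
    by (intro compact_imp_bounded compact_continuous_image continuous_on_subset[OF cont(1) r(2)]
        continuous_on_subset[OF cont(2) r(2)] compact_cball)+
  then obtain D0 G0 where "\<forall>w\<in>cball a r. norm (drho w) \<le> D0" "\<forall>w\<in>cball a r. norm (\<gamma> w) \<le> G0"
    unfolding bounded_iff by auto
  moreover define D G where "D = \<bar>D0\<bar>" "G = \<bar>G0\<bar>"
  ultimately have D: "0 \<le> D" "\<And>w. w \<in> cball a r \<Longrightarrow> norm (drho w) \<le> D"
    and G: "0 \<le> G" "\<And>w. w \<in> cball a r \<Longrightarrow> norm (\<gamma> w) \<le> G" by force+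
  have L: "0 \<le> L" "0 \<le> Lg" using lip glip by (auto dest: lipschitz_on_nonneg)
  \<comment> \<open>The gradient is rescaled so that its pairing with \<open>\<gamma>\<close> is
    one.\<close>
  define m where "m = (\<lambda>w. drho w /\<^sub>R g w)"
  \<comment> \<open>This value keeps \<open>k\<close> minus the squared length of
    \<open>\<gamma>\<close> at least one on the whole ball.\<close>
  define k where "k = 1 + G\<^sup>2"
  define M where "M = D / c1"
  \<comment> \<open>A Lipschitz constant of \<open>m\<close>, from the quotient estimate with
    denominators at least \<open>c1\<close>.\<close>
  define Lm where "Lm = L / c1 + D * (L * G + D * Lg) / c1\<^sup>2"
  have nn: "0 \<le> k" "0 \<le> M" "0 \<le> Lm" using L D(1) G(1) c1 by (auto simp: k_def M_def Lm_def)
  have dl: "norm (drho z - drho w) \<le> L * norm (z - w)" if "z \<in> cball a r" "w \<in> cball a r" for z w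
    using lipschitz_onD[OF lip subsetD[OF r(2) that(1)] subsetD[OF r(2) that(2)]] by (simp add: dist_norm)
  have gl: "norm (\<gamma> z - \<gamma> w) \<le> Lg * norm (z - w)" for z w
    using lipschitz_onD[OF glip, of z w] by (auto simp: dist_norm)
  have mg: "m w \<bullet> \<gamma> w = 1" if "w \<in> cball a r" for w
    using r(3)[OF that] c1(1) by (simp add: m_def g_def)
  have mM: "norm (m w) \<le> M" if "w \<in> cball a r" for w
    unfolding m_def M_def using r(3)[OF that] c1(1) D(2)[OF that] D(1)
    by (simp add: divide_inverse_commute[symmetric] frac_le)
  have ml: "norm (m z - m w) \<le> Lm * norm (z - w)" if zw: "z \<in> cball a r" "w \<in> cball a r" for z w
  proof -
    have "g z - g w = (drho z - drho w) \<bullet> \<gamma> z + drho w \<bullet> (\<gamma> z - \<gamma> w)"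
      by (simp add: g_def inner_diff)
    then have "\<bar>g z - g w\<bar> \<le> norm (drho z - drho w) * norm (\<gamma> z) + norm (drho w) * norm (\<gamma> z - \<gamma> w)"
      using Cauchy_Schwarz_ineq2[of "drho z - drho w" "\<gamma> z"] Cauchy_Schwarz_ineq2[of "drho w" "\<gamma> z - \<gamma> w"]
      by linarith
    also have "\<dots> \<le> L * norm (z - w) * G + D * (Lg * norm (z - w))"
      by (intro add_mono mult_mono dl gl D G zw) (auto simp: L D)
    finally have g: "\<bar>g z - g w\<bar> \<le> (L * G + D * Lg) * norm (z - w)" by (simp add: algebra_simps)
    have "norm (m z - m w) \<le> norm (drho z - drho w) / c1 + norm (drho w) * \<bar>g z - g w\<bar> / c1\<^sup>2"
      unfolding m_def using norm_inverse_scaleR_diff_le c1(1) r(3) zw by blast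
    also have "\<dots> \<le> L * norm (z - w) / c1 + D * ((L * G + D * Lg) * norm (z - w)) / c1\<^sup>2"
      by (intro add_mono divide_right_mono mult_mono dl g D zw) (use c1 D in auto)
    also have "\<dots> = Lm * norm (z - w)" by (simp add: Lm_def algebra_simps add_divide_distrib)
    finally show ?thesis .
  qed
  define q where "q = (\<lambda>w h. h - (m w \<bullet> h) *\<^sub>R \<gamma> w - (\<gamma> w \<bullet> h) *\<^sub>R m w + k *\<^sub>R ((m w \<bullet> h) *\<^sub>R m w))"
  \<comment> \<open>One constant has to serve both as the lower bound for \<open>l\<close> paired
    with \<open>\<gamma>\<close>, where \<open>c1\<close> is available, and as the ellipticity
    constant of the form.\<close>
  define c where "c = min c1 (1 / (2 * (1 + G\<^sup>2)))"
  \<comment> \<open>\<open>N1\<close> bounds the operator norm of the matrix, \<open>N2\<close> its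
    Lipschitz constant in the base point, and \<open>N3\<close> the quadratic error in the oblique
    inequality.\<close>
  define N1 N2 N3 where N: "N1 = 1 + 2 * (M * G) + k * (M * M)"
      "N2 = 2 * (Lm * G + M * Lg) + k * (2 * (M * Lm))" "N3 = k * (L / c1)"
  define C where "C = 1 + norm (drho a) + G + N1 + N2 + N3"
  have c: "0 < c" "c \<le> c1" "c * (2 * (1 + G\<^sup>2)) \<le> 1"
  proof -
    have p: "0 < 2 * (1 + G\<^sup>2)" by (auto intro: add_pos_nonneg)
    show "0 < c" "c \<le> c1" using c1 p unfolding c_def by auto
    have "c * (2 * (1 + G\<^sup>2)) \<le> 1 / (2 * (1 + G\<^sup>2)) * (2 * (1 + G\<^sup>2))"
      using p unfolding c_def by (intro mult_right_mono) auto
    then show "c * (2 * (1 + G\<^sup>2)) \<le> 1" using p by simp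
  qed
  have "0 \<le> N1" "0 \<le> N2" "0 \<le> N3"
    unfolding N using nn L G c1 by (auto intro!: add_nonneg_nonneg mult_nonneg_nonneg divide_nonneg_nonneg)
  then have C: "1 \<le> C" "norm (drho a) \<le> C" "G \<le> C" "N1 \<le> C" "N2 \<le> C" "N3 \<le> C"
    unfolding C_def using G(1) norm_ge_zero[of "drho a"] by (-, linarith+)
  let ?K = "closure Om \<inter> cball a r"
  have "oblique_frame Om \<gamma> a r c C q (drho a)"
    unfolding oblique_frame_def
  proof (intro conjI ballI allI)
    have Lc: "Lm-lipschitz_on (cball a r) m"
      using ml nn(3) by (intro lipschitz_onI) (auto simp: dist_norm)
    have "continuous_on ?K m" "continuous_on ?K \<gamma>"
      using lipschitz_on_continuous_on[OF Lc] lipschitz_on_continuous_on[OF glip]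
      by (auto intro: continuous_on_subset)
    then have "continuous_on (?K \<times> UNIV) (\<lambda>p. m (fst p))" "continuous_on (?K \<times> UNIV) (\<lambda>p. \<gamma> (fst p))"
      by (auto intro!: continuous_on_compose2[of ?K m] continuous_on_compose2[of ?K \<gamma>] continuous_intros)
    then show "continuous_on (?K \<times> (UNIV :: (real^'n) set)) (\<lambda>p. q (fst p) (snd p))"
      unfolding q_def by (auto intro!: continuous_intros)
  next
    fix z assume z: "z \<in> ?K"
    then have zr: "z \<in> cball a r" by simp
    show "linear (q z)" unfolding q_def by (intro linearI) (simp_all add: algebra_simps)
    show "norm (\<gamma> z) \<le> C" using G(2)[OF zr] C(3) by linarith
    show "q z h \<bullet> x = h \<bullet> q z x" for h x
      unfolding q_def by (simp add: algebra_simps inner_commute)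
    show "c * (norm h)\<^sup>2 \<le> q z h \<bullet> h" for h
    proof -
      define s where "s = m z \<bullet> h"
      \<comment> \<open>Completing the square splits \<open>h\<close> into a multiple of
        \<open>\<gamma> z\<close> and the remainder \<open>e\<close>. The two squares control
        \<open>h\<close> because \<open>\<gamma>\<close> is bounded by \<open>G\<close>.\<close>
      define e where "e = h - s *\<^sub>R \<gamma> z"
      have hs: "m z \<bullet> h = s" "h \<bullet> m z = s" by (simp_all add: s_def inner_commute)
      have "q z h \<bullet> h = (norm e)\<^sup>2 + (k - (norm (\<gamma> z))\<^sup>2) * s\<^sup>2"
        unfolding q_def e_def power2_norm_eq_inner
        by (simp add: hs algebra_simps power2_eq_square) (simp add: inner_commute)
      moreover have "(norm (\<gamma> z))\<^sup>2 \<le> G\<^sup>2" using G(2)[OF zr] by (intro power_mono) auto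
      then have "1 * s\<^sup>2 \<le> (k - (norm (\<gamma> z))\<^sup>2) * s\<^sup>2" unfolding k_def by (intro mult_right_mono) auto
      ultimately have lo: "(norm e)\<^sup>2 + s\<^sup>2 \<le> q z h \<bullet> h" by simp
      have "norm h \<le> norm e + \<bar>s\<bar> * norm (\<gamma> z)"
        using norm_triangle_ineq[of e "s *\<^sub>R \<gamma> z"] by (simp add: e_def)
      also have "\<dots> \<le> norm e + \<bar>s\<bar> * G" using G(2)[OF zr] by (intro add_left_mono mult_left_mono) auto
      finally have "(norm h)\<^sup>2 \<le> (norm e + \<bar>s\<bar> * G)\<^sup>2" by (intro power_mono) auto
      also have "\<dots> \<le> 2 * (norm e)\<^sup>2 + 2 * (\<bar>s\<bar> * G)\<^sup>2"
        using zero_le_power2[of "norm e - \<bar>s\<bar> * G"] by (simp add: power2_eq_square algebra_simps)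
      also have "\<dots> \<le> 2 * (1 + G\<^sup>2) * ((norm e)\<^sup>2 + s\<^sup>2)"
        by (simp add: power_mult_distrib algebra_simps)
      finally have "c * (norm h)\<^sup>2 \<le> c * (2 * (1 + G\<^sup>2)) * ((norm e)\<^sup>2 + s\<^sup>2)"
        using c(1) by (simp add: mult.assoc)
      also have "\<dots> \<le> 1 * ((norm e)\<^sup>2 + s\<^sup>2)" using c(3) by (intro mult_right_mono) auto
      finally show ?thesis using lo by simp
    qed
    show "norm (q z h) \<le> C * norm h" for h
    proof -
      have "\<bar>m z \<bullet> h\<bar> \<le> M * norm h" "\<bar>\<gamma> z \<bullet> h\<bar> \<le> G * norm h"
        using Cauchy_Schwarz_ineq2[of "m z" h] Cauchy_Schwarz_ineq2[of "\<gamma> z" h] mM[OF zr] G(2)[OF zr]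
        by (meson mult_right_mono norm_ge_zero order_trans)+
      then have A: "norm ((m z \<bullet> h) *\<^sub>R \<gamma> z) \<le> M * norm h * G" "norm ((\<gamma> z \<bullet> h) *\<^sub>R m z) \<le> G * norm h * M"
        "norm ((m z \<bullet> h) *\<^sub>R m z) \<le> M * norm h * M"
        unfolding norm_scaleR using mM[OF zr] G nn zr by (auto intro!: mult_mono)
      then have "norm (k *\<^sub>R ((m z \<bullet> h) *\<^sub>R m z)) \<le> k * (M * norm h * M)"
        using nn(1) by (simp only: norm_scaleR[of k] abs_of_nonneg mult_left_mono)
      with A have "norm (q z h) \<le> norm h + M * norm h * G + G * norm h * M + k * (M * norm h * M)"
        unfolding q_def by (intro norm_triangle_le order_trans[OF norm_triangle_ineq4] add_mono) auto
      also have "\<dots> = (1 + 2 * (M * G) + k * (M * M)) * norm h" by (simp add: algebra_simps)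
      also have "\<dots> \<le> C * norm h" using C(4) unfolding N by (intro mult_right_mono) auto
      finally show ?thesis .
    qed
    show "norm (q z h - q w h) \<le> C * norm (z - w) * norm h" if w: "w \<in> ?K" for w h
    proof -
      have wr: "w \<in> cball a r" using w by simp
      let ?d = "norm (z - w)"
      have A1: "norm ((m z \<bullet> h) *\<^sub>R \<gamma> z - (m w \<bullet> h) *\<^sub>R \<gamma> w) \<le> (Lm * ?d * G + M * (Lg * ?d)) * norm h"
        by (rule order_trans[OF norm_inner_scaleR_diff_le])
          (intro mult_right_mono add_mono mult_mono ml gl mM G zr wr, auto simp: nn)
      have A2: "norm ((\<gamma> z \<bullet> h) *\<^sub>R m z - (\<gamma> w \<bullet> h) *\<^sub>R m w) \<le> (Lg * ?d * M + G * (Lm * ?d)) * norm h"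
        by (rule order_trans[OF norm_inner_scaleR_diff_le])
          (intro mult_right_mono add_mono mult_mono ml gl mM G zr wr, auto simp: nn L G)
      have A3: "norm ((m z \<bullet> h) *\<^sub>R m z - (m w \<bullet> h) *\<^sub>R m w) \<le> (Lm * ?d * M + M * (Lm * ?d)) * norm h"
        by (rule order_trans[OF norm_inner_scaleR_diff_le])
          (intro mult_right_mono add_mono mult_mono ml gl mM G zr wr, auto simp: nn L G)
      have "q z h - q w h = k *\<^sub>R ((m z \<bullet> h) *\<^sub>R m z - (m w \<bullet> h) *\<^sub>R m w)
          - ((m z \<bullet> h) *\<^sub>R \<gamma> z - (m w \<bullet> h) *\<^sub>R \<gamma> w) - ((\<gamma> z \<bullet> h) *\<^sub>R m z - (\<gamma> w \<bullet> h) *\<^sub>R m w)"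
        unfolding q_def by (simp add: scaleR_diff_right)
      also have "norm \<dots> \<le> k * ((Lm * ?d * M + M * (Lm * ?d)) * norm h)
          + (Lm * ?d * G + M * (Lg * ?d)) * norm h + (Lg * ?d * M + G * (Lm * ?d)) * norm h"
      proof -
        have "norm (k *\<^sub>R ((m z \<bullet> h) *\<^sub>R m z - (m w \<bullet> h) *\<^sub>R m w)) \<le> k * ((Lm * ?d * M + M * (Lm * ?d)) * norm h)"
          using A3 nn(1) by (simp only: norm_scaleR[of k] abs_of_nonneg mult_left_mono)
        from order_trans[OF norm_triangle_ineq4 add_mono[OF order_trans[OF norm_triangle_ineq4 add_mono[OF this A1]] A2]]
        show ?thesis .
      qed
      also have "\<dots> = (2 * (Lm * G + M * Lg) + k * (2 * (M * Lm))) * ?d * norm h"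
        by (simp add: algebra_simps)
      also have "\<dots> \<le> C * ?d * norm h" using C(5) unfolding N by (intro mult_right_mono) auto
      finally show ?thesis .
    qed
  next
    fix x assume x: "x \<in> frontier Om \<inter> cball a r"
    then have xr: "x \<in> cball a r" by simp
    show "c \<le> drho a \<bullet> \<gamma> x" using r(3)[OF xr] c by linarith
    fix y assume y: "y \<in> ?K"
    have "- L * (norm (x - y))\<^sup>2 \<le> drho x \<bullet> (x - y)"
      using x y r(2) by (intro defining_function_oblique_bound[OF assms(1) der lip sub]) auto
    then have "- L * (norm (x - y))\<^sup>2 / g x \<le> drho x \<bullet> (x - y) / g x"
      using r(3)[OF xr] c1 by (intro divide_right_mono) auto
    moreover have "drho x \<bullet> (x - y) / g x = m x \<bullet> (x - y)" by (simp add: m_def divide_inverse mult.commute)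
    moreover have "L * (norm (x - y))\<^sup>2 / g x \<le> L / c1 * (norm (x - y))\<^sup>2"
      using r(3)[OF xr] c1 L by (auto intro!: divide_left_mono)
    ultimately have lo: "- (L / c1 * (norm (x - y))\<^sup>2) \<le> m x \<bullet> (x - y)" by simp
    have "(norm (\<gamma> x))\<^sup>2 \<le> G\<^sup>2" using G(2)[OF xr] by (intro power_mono) auto
    then have kk: "0 \<le> k - (norm (\<gamma> x))\<^sup>2" "k - (norm (\<gamma> x))\<^sup>2 \<le> k" by (auto simp: k_def)
    have "- C * (norm (x - y))\<^sup>2 \<le> - (k * (L / c1) * (norm (x - y))\<^sup>2)"
      using mult_right_mono[OF C(6), of "(norm (x - y))\<^sup>2"] unfolding N by simp
    also have "\<dots> \<le> - ((k - (norm (\<gamma> x))\<^sup>2) * (L / c1 * (norm (x - y))\<^sup>2))"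
      unfolding neg_le_iff_le mult.assoc using L c1 kk by (intro mult_right_mono) auto
    also have "\<dots> = (k - (norm (\<gamma> x))\<^sup>2) * - (L / c1 * (norm (x - y))\<^sup>2)" by simp
    also have "\<dots> \<le> (k - (norm (\<gamma> x))\<^sup>2) * (m x \<bullet> (x - y))"
      using lo kk by (intro mult_left_mono)
    also have "\<dots> = q x (x - y) \<bullet> \<gamma> x"
      using mg[OF xr] unfolding q_def by (simp add: algebra_simps power2_norm_eq_inner inner_commute)
    finally show "- C * (norm (x - y))\<^sup>2 \<le> q x (x - y) \<bullet> \<gamma> x" .
  qed (use r c C in auto)
  then show thesis by (rule that)
qed

lemma W2inf_domain_oblique_frame:
  fixes Om :: "(real^'n) set"
  assumes dom: "W2inf_domain Om nrm" and lip: "L-lipschitz_on UNIV \<gamma>"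
    and obl: "0 < c0" "\<And>x. x \<in> frontier Om \<Longrightarrow> c0 \<le> \<gamma> x \<bullet> nrm x" and a: "a \<in> closure Om"
  obtains r c C q l where "oblique_frame Om \<gamma> a r c C q l"
proof (cases "a \<in> Om")
  case True
  then show thesis
    using oblique_frame_interior[OF _ True lipschitz_on_continuous_on[OF lip]] dom that
    unfolding W2inf_domain_def by blast
next
  case False
  have "open Om" using dom unfolding W2inf_domain_def by blast
  then have fr: "a \<in> frontier Om" using False a by (auto simp: frontier_def interior_open)
  then obtain r rho drho L' where *: "r > 0"
    "\<And>y. y \<in> ball a r \<Longrightarrow> (rho has_derivative (\<lambda>h. drho y \<bullet> h)) (at y)"
    "L'-lipschitz_on (ball a r) drho" "drho a \<noteq> 0"
    "Om \<inter> ball a r = {y \<in> ball a r. rho y < 0}" "nrm a = drho a /\<^sub>R norm (drho a)"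
    using dom unfolding W2inf_domain_def by blast
  have "0 < \<gamma> a \<bullet> nrm a" using obl(1) obl(2)[OF fr] by linarith
  also have "\<dots> = drho a \<bullet> \<gamma> a / norm (drho a)" by (simp add: *(6) inner_commute divide_inverse)
  finally have "0 < drho a \<bullet> \<gamma> a" using *(4) by (simp add: zero_less_divide_iff)
  from oblique_frame_boundary[OF \<open>open Om\<close> fr *(1,2,3,5) lip this] that show thesis by blast
qed

section \<open>Consequences of the frame and local maxima on the cylinder\<close>

lemma oblique_frameD:
  assumes "oblique_frame Om \<gamma> a r c C q l"
  shows "0 < r" "0 < c" "1 \<le> C" "norm l \<le> C"
    and "continuous_on ((closure Om \<inter> cball a r) \<times> UNIV) (\<lambda>p. q (fst p) (snd p))"
    and "\<And>z. z \<in> closure Om \<inter> cball a r \<Longrightarrow> linear (q z)"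
    and "\<And>z. z \<in> closure Om \<inter> cball a r \<Longrightarrow> norm (\<gamma> z) \<le> C"
    and "\<And>z h k. z \<in> closure Om \<inter> cball a r \<Longrightarrow> q z h \<bullet> k = h \<bullet> q z k"
    and "\<And>z h. z \<in> closure Om \<inter> cball a r \<Longrightarrow> c * (norm h)\<^sup>2 \<le> q z h \<bullet> h"
    and "\<And>z h. z \<in> closure Om \<inter> cball a r \<Longrightarrow> norm (q z h) \<le> C * norm h"
    and "\<And>z w h. z \<in> closure Om \<inter> cball a r \<Longrightarrow> w \<in> closure Om \<inter> cball a r \<Longrightarrow>
          norm (q z h - q w h) \<le> C * norm (z - w) * norm h"
    and "\<And>x. x \<in> frontier Om \<inter> cball a r \<Longrightarrow> c \<le> l \<bullet> \<gamma> x"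
    and "\<And>x y. x \<in> frontier Om \<inter> cball a r \<Longrightarrow> y \<in> closure Om \<inter> cball a r \<Longrightarrow>
          - C * (norm (x - y))\<^sup>2 \<le> q x (x - y) \<bullet> \<gamma> x"
  using assms unfolding oblique_frame_def by blast+

text \<open>The sign information holds for the matrix at the boundary point \<open>x\<close>, but in
  the penalty the matrix sits at \<open>z\<close>. Lipschitz dependence prices the exchange, with a
  second factor \<open>C\<close> from the bound on \<open>\<gamma>\<close>.\<close>

lemma oblique_frame_inner_ge:
  assumes fr: "oblique_frame Om \<gamma> a r c C q l"
    and x: "x \<in> frontier Om \<inter> cball a r"
    and y: "y \<in> closure Om \<inter> cball a r" and z: "z \<in> closure Om \<inter> cball a r"
  shows "- (C * (norm (x - y))\<^sup>2 + C\<^sup>2 * norm (z - x) * norm (x - y)) \<le> q z (x - y) \<bullet> \<gamma> x"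
proof -
  note D = oblique_frameD[OF fr]
  have xK: "x \<in> closure Om \<inter> cball a r" using x by (auto simp: frontier_def)
  have "\<bar>(q z (x - y) - q x (x - y)) \<bullet> \<gamma> x\<bar> \<le> norm (q z (x - y) - q x (x - y)) * norm (\<gamma> x)"
    by (rule Cauchy_Schwarz_ineq2)
  also have "\<dots> \<le> (C * norm (z - x) * norm (x - y)) * C"
    using D(3) by (intro mult_mono D(11)[OF z xK] D(7)[OF xK]) auto
  finally have "- (C\<^sup>2 * norm (z - x) * norm (x - y)) \<le> (q z (x - y) - q x (x - y)) \<bullet> \<gamma> x"
    by (simp add: power2_eq_square mult_ac)
  with D(13)[OF x y] show ?thesis by (simp add: inner_diff_left)
qed

lemma dist_Pair_le: "dist (a, b) (c, d) \<le> dist a c + dist b d"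
  unfolding dist_Pair_Pair by (rule sqrt_sum_squares_le_sum) auto

text \<open>Maxima are found on the compact set cut off by the closed ball. Since \<open>x\<close>
  lies strictly inside the ball, all nearby points of the cylinder belong to that set, so such a
  maximum is local in the sense of the viscosity definitions.\<close>

lemma local_max_on_cylinderI:
  assumes x: "x \<in> closure Om" "dist a x < r" and t: "t \<in> {0..T}"
    and max: "\<And>t' x'. \<lbrakk>t' \<in> {0..T}; x' \<in> closure Om \<inter> cball a r\<rbrakk> \<Longrightarrow> f (t', x') \<le> f (t, x)"
  shows "local_max_on (cyl T Om) f (t, x)"
  unfolding local_max_on_def
proof (intro conjI exI[of _ "r - dist a x"] ballI impI)
  fix p assume p: "p \<in> cyl T Om" "dist p (t, x) < r - dist a x"
  obtain t' x' where p': "p = (t', x')" by (cases p)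
  have "dist x' x \<le> dist p (t, x)" using dist_snd_le[of p "(t, x)"] p' by simp
  then have "dist a x' \<le> r" using p(2) dist_triangle[of a x' x] by (simp add: dist_commute)
  then show "f p \<le> f (t, x)" using p(1) p' by (auto simp: cyl_def intro!: max)
qed (use x t in \<open>auto simp: cyl_def\<close>)

lemma Ham_ge: "norm (b (t, x)) \<le> B \<Longrightarrow> - (B * norm p) \<le> Ham \<sigma> b t x p"
  unfolding Ham_def
  by (smt (verit) Cauchy_Schwarz_ineq2 mult_right_mono norm_ge_zero zero_le_power2 divide_nonneg_pos mult_nonneg_nonneg)

section \<open>The terminal condition\<close>

text \<open>A strictly positive oblique derivative rules out the boundary alternative, so boundary
  points yield the same inequality as interior ones. As \<open>Eop\<close> is a minimum, its
  nonpositivity is a disjunction.\<close>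

lemma visc_sub_inequality:
  assumes sub: "visc_sub T Om \<gamma> \<sigma> b \<psi> w" and "open Om"
    and tf: "test_fun \<phi> \<phi>t \<phi>x" and max: "local_max_on (cyl T Om) (\<lambda>p. w p - \<phi> p) (t, x)"
    and bd: "x \<in> frontier Om \<Longrightarrow> 0 < \<phi>x (t, x) \<bullet> \<gamma> x"
  shows "- \<phi>t (t, x) + Ham \<sigma> b t x (\<phi>x (t, x)) \<le> 0 \<or> w (t, x) \<le> \<psi> (t, x)"
proof -
  have "(t, x) \<in> cyl T Om" using max unfolding local_max_on_def by blast
  then have "x \<in> Om \<or> x \<in> frontier Om" using \<open>open Om\<close> by (auto simp: cyl_def frontier_def interior_open)
  moreover have "let E0 = Eop \<sigma> b \<psi> t x (w (t, x)) (\<phi>t (t, x)) (\<phi>x (t, x)); g = \<phi>x (t, x) \<bullet> \<gamma> x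
      in (x \<in> Om \<longrightarrow> E0 \<le> 0) \<and> (x \<in> frontier Om \<longrightarrow> min E0 g \<le> 0)"
    using sub tf max unfolding visc_sub_def by blast
  ultimately have "Eop \<sigma> b \<psi> t x (w (t, x)) (\<phi>t (t, x)) (\<phi>x (t, x)) \<le> 0"
    using bd unfolding Let_def by (auto simp: min_le_iff_disj)
  then show ?thesis unfolding Eop_def by (auto simp: min_le_iff_disj)
qed

text \<open>Touching is phrased as a local maximum of \<open>- w - \<phi>\<close>, so that both
  solutions are handled by maxima of a penalised sum; the actual test function is
  \<open>- \<phi>\<close>, whose oblique derivative is negative. Nonnegativity of the minimum
  \<open>Eop\<close> is a conjunction, hence the obstacle bound at all times and the Hamiltonian
  inequality before \<open>T\<close>.\<close>

lemma visc_super_inequality: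
  assumes super: "visc_super T Om \<gamma> \<sigma> b \<psi> w" and "open Om"
    and tf: "test_fun \<phi> \<phi>t \<phi>x" and max: "local_max_on (cyl T Om) (\<lambda>p. - w p - \<phi> p) (t, x)"
    and bd: "x \<in> frontier Om \<Longrightarrow> 0 < \<phi>x (t, x) \<bullet> \<gamma> x"
  shows "\<psi> (t, x) \<le> w (t, x)" and "t < T \<Longrightarrow> 0 \<le> \<phi>t (t, x) + Ham \<sigma> b t x (- \<phi>x (t, x))"
proof -
  have "(t, x) \<in> cyl T Om" using max unfolding local_max_on_def by blast
  then have *: "x \<in> Om \<or> x \<in> frontier Om" "t < T \<or> t = T"
    using \<open>open Om\<close> by (auto simp: cyl_def frontier_def interior_open)
  have "local_min_on (cyl T Om) (\<lambda>p. w p - (-1) * \<phi> p) (t, x)"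
    using max unfolding local_max_on_def local_min_on_def by (auto simp: algebra_simps)
  moreover have "test_fun (\<lambda>p. (-1) * \<phi> p) (\<lambda>p. (-1) * \<phi>t p) (\<lambda>p. (-1) *\<^sub>R \<phi>x p)"
    by (rule test_fun_scale[OF tf])
  ultimately have S: "let E0 = Eop \<sigma> b \<psi> t x (w (t, x)) (-1 * \<phi>t (t, x)) (-1 *\<^sub>R \<phi>x (t, x)); g = (-1 *\<^sub>R \<phi>x (t, x)) \<bullet> \<gamma> x
      in (t < T \<and> x \<in> Om \<longrightarrow> E0 \<ge> 0) \<and> (t = T \<and> x \<in> Om \<longrightarrow> w (t, x) - \<psi> (t, x) \<ge> 0) \<and>
         (t < T \<and> x \<in> frontier Om \<longrightarrow> max E0 g \<ge> 0) \<and>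
         (t = T \<and> x \<in> frontier Om \<longrightarrow> max (w (t, x) - \<psi> (t, x)) g \<ge> 0)"
    using super unfolding visc_super_def by blast
  then show "\<psi> (t, x) \<le> w (t, x)" using * bd unfolding Let_def Eop_def by (auto simp: le_max_iff_disj)
  show "0 \<le> \<phi>t (t, x) + Ham \<sigma> b t x (- \<phi>x (t, x))" if "t < T"
    using that S * bd unfolding Let_def Eop_def by (auto simp: le_max_iff_disj)
qed

text \<open>The slope \<open>-\<kappa>\<close> in time, chosen after \<open>\<alpha>\<close>, beats the Hamiltonian, so at \<open>t = T\<close> only the obstacle
  part of the equation can hold.\<close>
lemma terminal_test_function:
  fixes Om :: "(real^'n) set" and \<sigma> :: "real \<times> (real^'n) \<Rightarrow> real^'m^'n"
  assumes "0 < T" "bounded Om" and a: "a \<in> closure Om"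
    and fr: "oblique_frame Om \<gamma> a r c C q l"
    and usc: "usc_on (cyl T Om) f" and bdd: "bounded (f ` cyl T Om)"
    and B: "\<forall>p \<in> cyl T Om. norm (b p) \<le> B" and "0 < e"
  obtains \<phi> \<phi>t \<phi>x t x where "test_fun \<phi> \<phi>t \<phi>x" "local_max_on (cyl T Om) (\<lambda>p. f p - \<phi> p) (t, x)"
    "dist (t, x) (T, a) < e" "f (T, a) - e < f (t, x)"
    "x \<in> frontier Om \<Longrightarrow> 0 < \<phi>x (t, x) \<bullet> \<gamma> x"
    "0 < - \<phi>t (t, x) + Ham \<sigma> b t x (\<phi>x (t, x))"
proof -
  note D = oblique_frameD[OF fr]
  let ?K = "closure Om \<inter> cball a r"
  have aK: "a \<in> ?K" using a D(1) by auto
  have Ta: "(T, a) \<in> cyl T Om" using a \<open>0 < T\<close> by (auto simp: cyl_def)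
  obtain F where F: "\<And>p. p \<in> cyl T Om \<Longrightarrow> \<bar>f p\<bar> \<le> F"
    using bdd unfolding bounded_iff by auto
  have "0 \<le> F" "0 \<le> B" using F[OF Ta] bspec[OF B Ta] norm_ge_zero[of "b (T, a)"] by linarith+
  \<comment> \<open>Chosen so that once the quadratic penalty at the maximum is below
    \<open>2 * \<eta>\<close>, its oblique derivative is at least \<open>- c / 2\<close>, which the
    vector \<open>l\<close> outweighs.\<close>
  define \<eta> where "\<eta> = c\<^sup>2 / (8 * (C + C\<^sup>2))"
  have CC: "0 < C + C\<^sup>2" using D(3) by (auto intro: add_pos_nonneg)
  then have "\<eta> > 0" unfolding \<eta>_def using D(2) by auto
  then obtain d where d: "d > 0" "\<And>p. p \<in> cyl T Om \<Longrightarrow> dist p (T, a) < d \<Longrightarrow> f p < f (T, a) + \<eta>"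
    using usc Ta unfolding usc_on_def by metis
  \<comment> \<open>The maximum will be confined to distance \<open>\<rho>\<close> in space and in
    time. The bound by \<open>d\<close> makes semicontinuity applicable, those by \<open>e\<close>
    and \<open>\<eta>\<close> control position and loss of value, and \<open>r\<close> keeps it in
    the ball of the frame.\<close>
  define \<rho> where "\<rho> = min (min (d / 2) (e / (2 * C))) (min (\<eta> / C) r)"
  have \<rho>: "0 < \<rho>" "\<rho> \<le> d / 2" "\<rho> \<le> e / (2 * C)" "\<rho> \<le> \<eta> / C" "\<rho> \<le> r"
  proof -
    show "0 < \<rho>" using d(1) \<open>0 < e\<close> D(1,3) \<open>\<eta> > 0\<close> by (simp add: \<rho>_def)
  qed (unfold \<rho>_def, linarith+)
  have "e / (2 * C) \<le> e / 2" using D(3) \<open>0 < e\<close> by (intro divide_left_mono) auto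
  then have "\<rho> \<le> e / 2" using \<rho>(3) by linarith
  moreover have "C * \<rho> \<le> e / 2" "C * \<rho> \<le> \<eta>" using \<rho>(3,4) D(3) by (auto simp: field_simps)
  ultimately have \<rho>': "\<rho> \<le> e / 2" "C * \<rho> \<le> e / 2" "C * \<rho> \<le> \<eta>" .
  \<comment> \<open>An a priori bound on the penalty at the maximum, from the bound on
    \<open>f\<close> and from the linear term.\<close>
  define B0 where "B0 = 2 * F + C * r"
  have "0 \<le> B0" using \<open>0 \<le> F\<close> D(1,3) by (simp add: B0_def)
  \<comment> \<open>With this \<open>\<alpha>\<close>, a penalty below \<open>B0 + 1\<close> forces
    the spatial distance below \<open>\<rho>\<close>.\<close>
  define \<alpha> where "\<alpha> = c * \<rho>\<^sup>2 / (B0 + 1)"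
  have \<alpha>: "0 < \<alpha>" unfolding \<alpha>_def using D(2) \<rho>(1) \<open>0 \<le> B0\<close> by auto
  \<comment> \<open>The first summand forces \<open>T - t < \<rho>\<close>; the second exceeds the
    drift bound times every gradient that can occur in the ball.\<close>
  define \<kappa> where "\<kappa> = (B0 + 1) / \<rho> + B * (2 / \<alpha> * (C * r) + C)"
  have \<kappa>: "(B0 + 1) / \<rho> \<le> \<kappa>" "B * (2 / \<alpha> * (C * r) + C) < \<kappa>"
    unfolding \<kappa>_def using \<open>0 \<le> B\<close> \<alpha> D(1,3) \<rho>(1) \<open>0 \<le> B0\<close> by auto
  have "0 < \<kappa>" using \<kappa>(1) \<rho>(1) \<open>0 \<le> B0\<close> by (smt (verit) divide_pos_pos)
  define \<phi> where "\<phi> = (\<lambda>p. 1 / \<alpha> * (q a (snd p - a) \<bullet> (snd p - a)) + l \<bullet> (snd p - a) + \<kappa> * (T - fst p))"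
  define \<phi>x where "\<phi>x = (\<lambda>p :: real \<times> (real^'n). (2 / \<alpha>) *\<^sub>R q a (snd p - a) + l)"
  have "test_fun \<phi> (\<lambda>p. 1 / \<alpha> * 0 + 0 + \<kappa> * (-1)) (\<lambda>p. (1 / \<alpha>) *\<^sub>R (2 *\<^sub>R q a (snd p - a)) + l + \<kappa> *\<^sub>R 0)"
    unfolding \<phi>_def
    by (intro test_fun_add test_fun_scale test_fun_quadratic test_fun_linear test_fun_time_linear D(6)[OF aK] D(8)[OF aK])
  then have tf: "test_fun \<phi> (\<lambda>p. - \<kappa>) \<phi>x" unfolding \<phi>x_def by simp
  have cont: "continuous_on UNIV \<phi>"
    using has_derivative_continuous[OF test_funD(1)[OF tf]] by (simp add: continuous_on_eq_continuous_at)
  have K: "{0..T} \<times> ?K \<subseteq> cyl T Om" by (auto simp: cyl_def)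
  have "compact ({0..T} \<times> ?K)"
    using \<open>bounded Om\<close> by (intro compact_Times compact_Int_closed) (auto simp: compact_closure)
  moreover have "{0..T} \<times> ?K \<noteq> {}" using aK \<open>0 < T\<close> by auto
  moreover have "usc_on ({0..T} \<times> ?K) (\<lambda>p. f p + - \<phi> p)"
    by (intro usc_on_add usc_on_continuous usc_on_compose[OF usc, where g = "\<lambda>p. p"] continuous_intros
        continuous_on_subset[OF cont]) (use K in auto)
  ultimately obtain p where p: "p \<in> {0..T} \<times> ?K" "\<And>p'. p' \<in> {0..T} \<times> ?K \<Longrightarrow> f p' + - \<phi> p' \<le> f p + - \<phi> p"
    using usc_attains_max by blast
  obtain t x where [simp]: "p = (t, x)" by (cases p)
  have t: "t \<in> {0..T}" and x: "x \<in> ?K" using p(1) by auto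
  define X where "X = norm (x - a)"
  have X: "0 \<le> X" "X \<le> r" using x by (auto simp: X_def dist_norm norm_minus_commute)
  have "q a 0 = 0" using linear_0[OF D(6)[OF aK]] .
  then have "\<phi> (T, a) = 0" by (simp add: \<phi>_def)
  then have m: "f (T, a) \<le> f (t, x) - \<phi> (t, x)" using p(2)[of "(T, a)"] aK \<open>0 < T\<close> by auto
  have tx: "(t, x) \<in> cyl T Om" using K p(1) by auto
  have "\<bar>l \<bullet> (x - a)\<bar> \<le> C * X"
    unfolding X_def by (rule order_trans[OF Cauchy_Schwarz_ineq2]) (intro mult_right_mono D(4), simp)
  moreover have "1 / \<alpha> * (c * X\<^sup>2) \<le> 1 / \<alpha> * (q a (x - a) \<bullet> (x - a))"
    unfolding X_def using \<alpha> by (intro mult_left_mono D(9)[OF aK]) auto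
  ultimately have lo: "c * X\<^sup>2 / \<alpha> + \<kappa> * (T - t) \<le> f (t, x) - f (T, a) + C * X"
    using m unfolding \<phi>_def by simp
  have "C * X \<le> C * r" using X D(3) by (intro mult_left_mono) auto
  then have lo': "c * X\<^sup>2 / \<alpha> + \<kappa> * (T - t) \<le> B0"
    using lo F[OF Ta] F[OF tx] unfolding B0_def by linarith
  have nn: "0 \<le> c * X\<^sup>2 / \<alpha>" "0 \<le> \<kappa> * (T - t)" using D(2) \<alpha> \<open>0 < \<kappa>\<close> t by auto
  have "c * X\<^sup>2 / \<alpha> < B0 + 1" using lo' nn by linarith
  then have "X\<^sup>2 < (B0 + 1) * \<alpha> / c" using \<alpha> D(2) by (simp add: field_simps)
  also have "\<dots> = \<rho>\<^sup>2" unfolding \<alpha>_def using D(2) \<open>0 \<le> B0\<close> by simp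
  finally have X\<rho>: "X < \<rho>" using \<rho>(1) by (simp add: power_less_imp_less_base)
  have "(B0 + 1) / \<rho> * (T - t) \<le> \<kappa> * (T - t)" using \<kappa>(1) t by (intro mult_right_mono) auto
  then have "(B0 + 1) / \<rho> * (T - t) < B0 + 1" using lo' nn by linarith
  then have "(B0 + 1) * (T - t) < (B0 + 1) * \<rho>" using \<rho>(1) by (simp add: field_simps)
  then have t\<rho>: "T - t < \<rho>" using \<open>0 \<le> B0\<close> mult_less_cancel_left_pos[of "B0 + 1"] by simp
  have dst: "dist (t, x) (T, a) < 2 * \<rho>"
    using dist_Pair_le[of t x T a] X\<rho> t\<rho> t by (auto simp: X_def dist_norm)
  have CX: "C * X \<le> C * \<rho>" using X\<rho> D(3) by (intro mult_left_mono) auto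
  \<comment> \<open>Bootstrap: the a priori bound has placed the maximum close to
    \<open>(T, a)\<close>, where semicontinuity sharpens the bound on the quadratic penalty from
    \<open>B0\<close> to \<open>2 * \<eta>\<close>.\<close>
  have "f (t, x) < f (T, a) + \<eta>" using d(2)[OF tx] dst \<rho>(2) by simp
  then have hi: "c * X\<^sup>2 / \<alpha> < 2 * \<eta>" using lo nn CX \<rho>'(3) by linarith
  show thesis
  proof (rule that[OF tf])
    show "local_max_on (cyl T Om) (\<lambda>p. f p - \<phi> p) (t, x)"
      using p(2) x X\<rho> \<rho>(5) t by (intro local_max_on_cylinderI[of _ _ a r]) (auto simp: X_def dist_norm norm_minus_commute)
    show "dist (t, x) (T, a) < e" using dst \<rho>' by simp
    show "f (T, a) - e < f (t, x)" using lo nn CX \<rho>' \<open>0 < e\<close> by linarith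
    have "norm (\<phi>x (t, x)) \<le> 2 / \<alpha> * (C * r) + C"
    proof -
      have "norm (q a (x - a)) \<le> C * r"
        using D(10)[OF aK, of "x - a"] \<open>C * X \<le> C * r\<close> by (simp add: X_def)
      then show ?thesis unfolding \<phi>x_def using D(4) \<alpha>
        by (intro norm_triangle_le add_mono) (auto intro!: divide_right_mono mult_left_mono)
    qed
    then have "B * norm (\<phi>x (t, x)) \<le> B * (2 / \<alpha> * (C * r) + C)" using \<open>0 \<le> B\<close> by (intro mult_left_mono)
    then show "0 < - (- \<kappa>) + Ham \<sigma> b t x (\<phi>x (t, x))"
      using Ham_ge[where p = "\<phi>x (t, x)" and \<sigma> = \<sigma> and b = b, OF bspec[OF B tx]] \<kappa>(2) by linarith
    assume "x \<in> frontier Om"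
    then have xf: "x \<in> frontier Om \<inter> cball a r" using x by auto
    have "- ((C + C\<^sup>2) * X\<^sup>2) \<le> q a (x - a) \<bullet> \<gamma> x"
      using oblique_frame_inner_ge[OF fr xf aK aK]
      by (simp add: X_def norm_minus_commute power2_eq_square algebra_simps)
    then have "2 / \<alpha> * - ((C + C\<^sup>2) * X\<^sup>2) \<le> 2 / \<alpha> * (q a (x - a) \<bullet> \<gamma> x)"
      using \<alpha> by (intro mult_left_mono) auto
    moreover have "2 / \<alpha> * ((C + C\<^sup>2) * X\<^sup>2) \<le> c / 2"
    proof -
      have N: "2 * N / c * (2 * (c\<^sup>2 / (8 * N))) = c / 2" if "0 < N" for N
        using that D(2) by (simp add: field_simps power2_eq_square)
      have "2 / \<alpha> * ((C + C\<^sup>2) * X\<^sup>2) = 2 * (C + C\<^sup>2) / c * (c * X\<^sup>2 / \<alpha>)"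
        using D(2) by simp
      also have "\<dots> \<le> 2 * (C + C\<^sup>2) / c * (2 * \<eta>)"
        using hi CC D(2) by (intro mult_left_mono) auto
      also have "\<dots> = c / 2" unfolding \<eta>_def by (rule N[OF CC])
      finally show ?thesis .
    qed
    ultimately have "- (c / 2) \<le> 2 / \<alpha> * (q a (x - a) \<bullet> \<gamma> x)"
      unfolding mult_minus_right by (meson neg_le_iff_le order_trans)
    moreover have "\<phi>x (t, x) \<bullet> \<gamma> x = 2 / \<alpha> * (q a (x - a) \<bullet> \<gamma> x) + l \<bullet> \<gamma> x"
      by (simp add: \<phi>x_def inner_add_left)
    ultimately show "0 < \<phi>x (t, x) \<bullet> \<gamma> x" using D(12)[OF xf] D(2) by linarith
  qed
qed

section \<open>Terminal inequalities for the two solutions\<close>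

text \<open>At the contact point the Hamiltonian alternative is excluded by its strict sign, so the
  obstacle bound holds there. Contact points come arbitrarily close to \<open>(T, a)\<close> with
  values almost as large as \<open>u (T, a)\<close>, and continuity of \<open>\<psi>\<close> carries
  the bound over.\<close>

lemma visc_sub_terminal_le:
  fixes Om :: "(real^'n) set" and \<sigma> :: "real \<times> (real^'n) \<Rightarrow> real^'m^'n"
  assumes "0 < T" "bounded Om" "open Om" and a: "a \<in> closure Om"
    and fr: "oblique_frame Om \<gamma> a r c C q l"
    and B: "\<forall>p \<in> cyl T Om. norm (b p) \<le> B"
    and psi: "continuous_on (cyl T Om) \<psi>" and sub: "visc_sub T Om \<gamma> \<sigma> b \<psi> u"
  shows "u (T, a) \<le> \<psi> (T, a)"
proof (rule field_le_epsilon)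
  fix e :: real assume "0 < e"
  have Ta: "(T, a) \<in> cyl T Om" using a \<open>0 < T\<close> by (auto simp: cyl_def)
  obtain d where d: "d > 0" "\<And>p. p \<in> cyl T Om \<Longrightarrow> dist p (T, a) < d \<Longrightarrow> dist (\<psi> p) (\<psi> (T, a)) < e / 2"
    using psi Ta \<open>0 < e\<close> unfolding continuous_on_iff by (metis half_gt_zero)
  have us: "usc_on (cyl T Om) u" "bounded (u ` cyl T Om)" using sub unfolding visc_sub_def by auto
  have "0 < min d (e / 2)" using d(1) \<open>0 < e\<close> by simp
  from terminal_test_function[OF assms(1,2) a fr us B this, where \<sigma> = \<sigma>]
  obtain \<phi> \<phi>t \<phi>x t x where p: "test_fun \<phi> \<phi>t \<phi>x" "local_max_on (cyl T Om) (\<lambda>p. u p - \<phi> p) (t, x)"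
    "dist (t, x) (T, a) < min d (e / 2)" "u (T, a) - min d (e / 2) < u (t, x)"
    "x \<in> frontier Om \<Longrightarrow> 0 < \<phi>x (t, x) \<bullet> \<gamma> x" "0 < - \<phi>t (t, x) + Ham \<sigma> b t x (\<phi>x (t, x))"
    by blast
  have tx: "(t, x) \<in> cyl T Om" using p(2) unfolding local_max_on_def by blast
  have "u (t, x) \<le> \<psi> (t, x)"
    using visc_sub_inequality[OF sub \<open>open Om\<close> p(1,2,5)] p(6) by linarith
  moreover have "dist (\<psi> (t, x)) (\<psi> (T, a)) < e / 2" using d(2)[OF tx] p(3) by simp
  ultimately show "u (T, a) \<le> \<psi> (T, a) + e" using p(4) unfolding dist_real_def by linarith
qed

text \<open>The same contact points, now for \<open>- v\<close>. The obstacle bound for a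
  supersolution is available at every time, so the contact point may lie before
  \<open>T\<close>.\<close>

lemma visc_super_terminal_ge:
  fixes Om :: "(real^'n) set" and \<sigma> :: "real \<times> (real^'n) \<Rightarrow> real^'m^'n"
  assumes "0 < T" "bounded Om" "open Om" and a: "a \<in> closure Om"
    and fr: "oblique_frame Om \<gamma> a r c C q l"
    and B: "\<forall>p \<in> cyl T Om. norm (b p) \<le> B"
    and psi: "continuous_on (cyl T Om) \<psi>" and super: "visc_super T Om \<gamma> \<sigma> b \<psi> v"
  shows "\<psi> (T, a) \<le> v (T, a)"
proof (rule field_le_epsilon)
  fix e :: real assume "0 < e"
  have Ta: "(T, a) \<in> cyl T Om" using a \<open>0 < T\<close> by (auto simp: cyl_def)
  obtain d where d: "d > 0" "\<And>p. p \<in> cyl T Om \<Longrightarrow> dist p (T, a) < d \<Longrightarrow> dist (\<psi> p) (\<psi> (T, a)) < e / 2"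
    using psi Ta \<open>0 < e\<close> unfolding continuous_on_iff by (metis half_gt_zero)
  have us: "usc_on (cyl T Om) (\<lambda>p. - v p)" "bounded ((\<lambda>p. - v p) ` cyl T Om)"
    using super usc_on_uminus_lsc unfolding visc_super_def by (auto simp: bounded_iff)
  have "0 < min d (e / 2)" using d(1) \<open>0 < e\<close> by simp
  from terminal_test_function[OF assms(1,2) a fr us B this, where \<sigma> = \<sigma>]
  obtain \<phi> \<phi>t \<phi>x t x where p: "test_fun \<phi> \<phi>t \<phi>x" "local_max_on (cyl T Om) (\<lambda>p. - v p - \<phi> p) (t, x)"
    "dist (t, x) (T, a) < min d (e / 2)" "- v (T, a) - min d (e / 2) < - v (t, x)"
    "x \<in> frontier Om \<Longrightarrow> 0 < \<phi>x (t, x) \<bullet> \<gamma> x" "0 < - \<phi>t (t, x) + Ham \<sigma> b t x (\<phi>x (t, x))"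
    by blast
  have tx: "(t, x) \<in> cyl T Om" using p(2) unfolding local_max_on_def by blast
  have "\<psi> (t, x) \<le> v (t, x)"
    by (rule visc_super_inequality(1)[OF super \<open>open Om\<close> p(1,2,5)])
  moreover have "dist (\<psi> (t, x)) (\<psi> (T, a)) < e / 2" using d(2)[OF tx] p(3) by simp
  ultimately show "\<psi> (T, a) \<le> v (T, a) + e" using p(4) unfolding dist_real_def by linarith
qed

section \<open>Doubling of variables\<close>

text \<open>The terms in \<open>x - a\<close> and \<open>t - t0\<close> localise
  \<open>(t, x)\<close> at the unperturbed maximum, and \<open>(s, y)\<close> is localised only
  through its closeness to \<open>(t, x)\<close>. The linear term occurs for both \<open>x\<close>
  and \<open>y\<close> because either may lie on the boundary.\<close>

definition doubling_penalty ::
  "(real^'n \<Rightarrow> real^'n \<Rightarrow> real^'n) \<Rightarrow> real^'n \<Rightarrow> real^'n \<Rightarrow> real \<Rightarrow> real \<Rightarrow> real \<Rightarrow> real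
    \<Rightarrow> real \<Rightarrow> real \<Rightarrow> real^'n \<Rightarrow> real^'n \<Rightarrow> real^'n \<Rightarrow> real" where
  "doubling_penalty q l a t0 \<delta> \<epsilon> \<tau> t s x y z =
     1 / \<epsilon> * (q z (x - y) \<bullet> (x - y)) + 1 / \<tau> * (t - s)\<^sup>2 + 1 / \<epsilon> * ((x - z) \<bullet> (x - z))
     + q a (x - a) \<bullet> (x - a) + (t - t0)\<^sup>2 + \<delta> * (l \<bullet> (x - a)) + \<delta> * (l \<bullet> (y - a))"

lemma test_fun_const: "test_fun (\<lambda>p. k) (\<lambda>p. 0) (\<lambda>p. 0)"
  by (rule test_funI) auto

lemma test_fun_doubling_penalty_fst:
  assumes "linear (q z)" "\<And>h k. q z h \<bullet> k = h \<bullet> q z k" "linear (q a)" "\<And>h k. q a h \<bullet> k = h \<bullet> q a k"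
  shows "test_fun (\<lambda>p. doubling_penalty q l a t0 \<delta> \<epsilon> \<tau> (fst p) s (snd p) y z)
    (\<lambda>p. 2 / \<tau> * (fst p - s) + 2 * (fst p - t0))
    (\<lambda>p. (2 / \<epsilon>) *\<^sub>R q z (snd p - y) + (2 / \<epsilon>) *\<^sub>R (snd p - z) + 2 *\<^sub>R q a (snd p - a) + \<delta> *\<^sub>R l)"
proof -
  have "test_fun (\<lambda>p. 1 / \<epsilon> * (q z (snd p - y) \<bullet> (snd p - y)) + 1 / \<tau> * (fst p - s)\<^sup>2
      + 1 / \<epsilon> * ((snd p - z) \<bullet> (snd p - z)) + q a (snd p - a) \<bullet> (snd p - a) + (fst p - t0)\<^sup>2
      + \<delta> * (l \<bullet> (snd p - a)) + \<delta> * (l \<bullet> (y - a)))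
    (\<lambda>p. 1 / \<epsilon> * 0 + 1 / \<tau> * (2 * (fst p - s)) + 1 / \<epsilon> * 0 + 0 + 2 * (fst p - t0) + \<delta> * 0 + 0)
    (\<lambda>p. (1 / \<epsilon>) *\<^sub>R (2 *\<^sub>R q z (snd p - y)) + (1 / \<tau>) *\<^sub>R 0 + (1 / \<epsilon>) *\<^sub>R (2 *\<^sub>R (snd p - z))
      + 2 *\<^sub>R q a (snd p - a) + 0 + \<delta> *\<^sub>R l + 0)"
    by (intro test_fun_add test_fun_scale test_fun_quadratic test_fun_quadratic[where q = "\<lambda>h. h"]
        test_fun_time_quadratic test_fun_linear test_fun_const assms) (simp_all add: linear_id[unfolded id_def])
  then show ?thesis unfolding doubling_penalty_def by simp
qed

text \<open>Linearity of \<open>q z\<close> makes the form even, so it can be differentiated as a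
  form in \<open>y - x\<close>. Its gradient in \<open>y\<close> is therefore exactly opposite to
  its gradient in \<open>x\<close>.\<close>

lemma test_fun_doubling_penalty_snd:
  assumes "linear (q z)" "\<And>h k. q z h \<bullet> k = h \<bullet> q z k"
  shows "test_fun (\<lambda>p. doubling_penalty q l a t0 \<delta> \<epsilon> \<tau> t (fst p) x (snd p) z)
    (\<lambda>p. 2 / \<tau> * (fst p - t))
    (\<lambda>p. (2 / \<epsilon>) *\<^sub>R q z (snd p - x) + \<delta> *\<^sub>R l)"
proof -
  have "q z (x - y) \<bullet> (x - y) = q z (y - x) \<bullet> (y - x)" for y
  proof -
    have "q z (x - y) = - q z (y - x)" using linear_neg[OF assms(1), of "y - x"] by simp
    moreover have "x - y = - (y - x)" by simp
    ultimately show ?thesis by (simp only: inner_minus_left inner_minus_right minus_minus)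
  qed
  then have eq: "doubling_penalty q l a t0 \<delta> \<epsilon> \<tau> t (fst p) x (snd p) z =
      1 / \<epsilon> * (q z (snd p - x) \<bullet> (snd p - x)) + 1 / \<tau> * (fst p - t)\<^sup>2
      + (1 / \<epsilon> * ((x - z) \<bullet> (x - z)) + q a (x - a) \<bullet> (x - a) + (t - t0)\<^sup>2 + \<delta> * (l \<bullet> (x - a)))
      + \<delta> * (l \<bullet> (snd p - a))" for p
    unfolding doubling_penalty_def by (simp add: power2_commute)
  have "test_fun (\<lambda>p. 1 / \<epsilon> * (q z (snd p - x) \<bullet> (snd p - x)) + 1 / \<tau> * (fst p - t)\<^sup>2
      + (1 / \<epsilon> * ((x - z) \<bullet> (x - z)) + q a (x - a) \<bullet> (x - a) + (t - t0)\<^sup>2 + \<delta> * (l \<bullet> (x - a)))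
      + \<delta> * (l \<bullet> (snd p - a)))
    (\<lambda>p. 1 / \<epsilon> * 0 + 1 / \<tau> * (2 * (fst p - t)) + 0 + \<delta> * 0)
    (\<lambda>p. (1 / \<epsilon>) *\<^sub>R (2 *\<^sub>R q z (snd p - x)) + (1 / \<tau>) *\<^sub>R 0 + 0 + \<delta> *\<^sub>R l)"
    by (intro test_fun_add test_fun_scale test_fun_quadratic
        test_fun_time_quadratic test_fun_linear test_fun_const assms)
  then show ?thesis unfolding eq by simp
qed

lemma continuous_on_doubling_penalty:
  assumes cont: "continuous_on (K \<times> UNIV) (\<lambda>p. q (fst p) (snd p))" and a: "a \<in> K"
    and "0 < \<epsilon>" "0 < \<tau>"
  shows "continuous_on ((A \<times> B) \<times> K \<times> E \<times> K)
    (\<lambda>w. doubling_penalty q l a t0 \<delta> \<epsilon> \<tau> (fst (fst w)) (snd (fst w)) (fst (snd w)) (fst (snd (snd w))) (snd (snd (snd w))))"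
    (is "continuous_on ?D _")
proof -
  have "continuous_on ?D (\<lambda>w. q (fst (snd (snd (snd w)), fst (snd w) - fst (snd (snd w))))
      (snd (snd (snd (snd w)), fst (snd w) - fst (snd (snd w)))))"
    by (rule continuous_on_compose2[OF cont]) (auto intro!: continuous_intros)
  moreover have "continuous_on ?D (\<lambda>w. q (fst (a, fst (snd w) - a)) (snd (a, fst (snd w) - a)))"
    by (rule continuous_on_compose2[OF cont]) (use a in \<open>auto intro!: continuous_intros\<close>)
  ultimately show ?thesis using assms(3,4) unfolding doubling_penalty_def by (auto intro!: continuous_intros)
qed

text \<open>The modulus \<open>dm\<close> lets \<open>\<tau>\<close> be chosen after \<open>\<epsilon>\<close>: the coefficients are merely continuous in time,
  and \<open>|t - s|\<close> must make their oscillation small compared with \<open>\<epsilon>\<close>.\<close>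
lemma doubling_max:
  fixes Om :: "(real^'n) set"
  assumes "bounded Om" and a: "a \<in> closure Om" and t0: "t0 \<in> {0..T}"
    and fr: "oblique_frame Om \<gamma> a r c C q l"
    and U: "usc_on (cyl T Om) U" "\<And>p. p \<in> cyl T Om \<Longrightarrow> \<bar>U p\<bar> \<le> F"
    and W: "usc_on (cyl T Om) W" "\<And>p. p \<in> cyl T Om \<Longrightarrow> \<bar>W p\<bar> \<le> F"
    and max: "\<And>p. p \<in> cyl T Om \<Longrightarrow> U p + W p \<le> U (t0, a) + W (t0, a)"
    and C1: "C1 = (1 + C + 2 * C\<^sup>2 / c) * (1 + 2 / c)"
    and \<delta>: "0 < \<delta>" "\<delta> \<le> 1" "(C1 + 1) * \<delta> < r"
    and d0: "0 < d0" and dm: "\<And>\<epsilon>. 0 < \<epsilon> \<Longrightarrow> 0 < dm \<epsilon>"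
  obtains \<epsilon> \<tau> t s x y z where "0 < \<epsilon>" "\<epsilon> \<le> \<delta>" "0 < \<tau>" "t \<in> {0..T}" "s \<in> {0..T}"
    "x \<in> closure Om \<inter> cball a r" "y \<in> closure Om \<inter> cball a r" "z \<in> closure Om \<inter> cball a r"
    "\<bar>t - s\<bar> < dm \<epsilon>" "\<bar>t - s\<bar> < d0" "norm (x - y) < d0" "norm (x - y) \<le> \<delta>"
    "(norm (x - y))\<^sup>2 \<le> C1 * \<delta>\<^sup>2 * \<epsilon>" "(norm (x - a))\<^sup>2 \<le> C1 * \<delta>\<^sup>2" "(t - t0)\<^sup>2 \<le> C1 * \<delta>\<^sup>2"
    "norm (x - z) \<le> C * (norm (x - y))\<^sup>2"
    "U (t0, a) + W (t0, a) \<le> U (t, x) + W (s, y) + C * (2 * C1 + 1) * \<delta>"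
    "local_max_on (cyl T Om) (\<lambda>p. U p - doubling_penalty q l a t0 \<delta> \<epsilon> \<tau> (fst p) s (snd p) y z) (t, x)"
    "local_max_on (cyl T Om) (\<lambda>p. W p - doubling_penalty q l a t0 \<delta> \<epsilon> \<tau> t (fst p) x (snd p) z) (s, y)"
proof -
  note D = oblique_frameD[OF fr]
  let ?K = "closure Om \<inter> cball a r"
  have aK: "a \<in> ?K" using a D(1) by auto
  have K: "{0..T} \<times> ?K \<subseteq> cyl T Om" by (auto simp: cyl_def)
  have compK: "compact ?K" using \<open>bounded Om\<close> by (intro compact_Int_closed) (auto simp: compact_closure)
  have compC: "compact (cyl T Om)"
    unfolding cyl_def using \<open>bounded Om\<close> by (intro compact_Times) (auto simp: compact_closure)
  have q0: "q w 0 = 0" if "w \<in> ?K" for w using linear_0[OF D(6)[OF that]] .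
  define C0 where "C0 = 1 + C + 2 * C\<^sup>2 / c"
  have C0: "1 \<le> C0" unfolding C0_def using D(2,3) by auto
  have C1': "C1 = C0 + C0 * (2 / c)" unfolding C1 C0_def[symmetric] by (simp add: distrib_left)
  have C1ge: "C0 \<le> C1" "C0 * (2 / c) \<le> C1" "1 \<le> C1" unfolding C1' using C0 D(2) by (auto intro: add_increasing2)
  let ?M = "U (t0, a) + W (t0, a)"
  have "0 < \<delta>\<^sup>2" using \<delta>(1) by simp
  \<comment> \<open>The tolerance is quadratic in \<open>\<delta>\<close>, so that later every term
    of the penalty is also of second order.\<close>
  obtain d1 where d1: "d1 > 0" "\<And>p p'. \<lbrakk>p \<in> cyl T Om; p' \<in> cyl T Om; dist p p' < d1\<rbrakk> \<Longrightarrow> U p + W p' \<le> ?M + \<delta>\<^sup>2"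
    using usc_near_diagonal[OF compC U(1) W(1) max \<open>0 < \<delta>\<^sup>2\<close>] by blast
  define B1 where "B1 = 4 * F + 2 * C * r"
  have "0 \<le> F" using U(2)[of "(t0, a)"] t0 a by (force simp: cyl_def)
  then have "0 \<le> B1" unfolding B1_def using D(1,3) by simp
  define \<rho> where "\<rho> = min (d1 / 2) (min \<delta> d0)"
  have \<rho>: "0 < \<rho>" "\<rho> \<le> d1 / 2" "\<rho> \<le> \<delta>" "\<rho> \<le> d0"
  proof -
    show "0 < \<rho>" using d1(1) \<delta>(1) d0 by (simp add: \<rho>_def)
  qed (unfold \<rho>_def, linarith+)
  \<comment> \<open>Against the a priori bound \<open>B1\<close>, this choice forces the distance of
    \<open>x\<close> and \<open>y\<close> below \<open>\<rho>\<close>. The choice of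
    \<open>\<tau>\<close> below does the same for the times, with the radius that depends on
    \<open>\<epsilon>\<close> through \<open>dm\<close>.\<close>
  define \<epsilon> where "\<epsilon> = min \<delta> (c * \<rho>\<^sup>2 / (B1 + 1))"
  have \<epsilon>: "0 < \<epsilon>" "\<epsilon> \<le> \<delta>" "\<epsilon> \<le> c * \<rho>\<^sup>2 / (B1 + 1)"
    unfolding \<epsilon>_def using \<delta>(1) D(2) \<rho>(1) \<open>0 \<le> B1\<close> by auto
  define \<sigma> where "\<sigma> = min \<rho> (dm \<epsilon>)"
  have \<sigma>: "0 < \<sigma>" "\<sigma> \<le> \<rho>" "\<sigma> \<le> dm \<epsilon>" unfolding \<sigma>_def using \<rho>(1) dm[OF \<epsilon>(1)] by auto
  define \<tau> where "\<tau> = \<sigma>\<^sup>2 / (B1 + 1)"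
  have \<tau>: "0 < \<tau>" unfolding \<tau>_def using \<sigma>(1) \<open>0 \<le> B1\<close> by auto
  let ?P = "doubling_penalty q l a t0 \<delta> \<epsilon> \<tau>"
  let ?D = "({0..T} \<times> {0..T}) \<times> ?K \<times> ?K \<times> ?K"
  have "compact ?D" by (intro compact_Times compK compact_Icc)
  moreover have "?D \<noteq> {}" using aK t0 by auto
  moreover have "usc_on ?D (\<lambda>w. U (fst (fst w), fst (snd w)) + W (snd (fst w), fst (snd (snd w)))
      + - ?P (fst (fst w)) (snd (fst w)) (fst (snd w)) (fst (snd (snd w))) (snd (snd (snd w))))"
    by (intro usc_on_add usc_on_continuous usc_on_compose[OF U(1)] usc_on_compose[OF W(1)] continuous_intros
        continuous_on_doubling_penalty[OF D(5) aK \<epsilon>(1) \<tau>]) (auto simp: cyl_def)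
  ultimately obtain w where w: "w \<in> ?D"
    "\<And>w'. w' \<in> ?D \<Longrightarrow> U (fst (fst w'), fst (snd w')) + W (snd (fst w'), fst (snd (snd w')))
      + - ?P (fst (fst w')) (snd (fst w')) (fst (snd w')) (fst (snd (snd w'))) (snd (snd (snd w'))) \<le>
      U (fst (fst w), fst (snd w)) + W (snd (fst w), fst (snd (snd w)))
      + - ?P (fst (fst w)) (snd (fst w)) (fst (snd w)) (fst (snd (snd w))) (snd (snd (snd w)))"
    by (rule usc_attains_max) metis
  obtain t s x y z where w_eq: "w = ((t, s), x, y, z)" by (metis surj_pair)
  have ts: "t \<in> {0..T}" "s \<in> {0..T}" and x: "x \<in> ?K" and y: "y \<in> ?K" and z: "z \<in> ?K"
    using w(1) w_eq by auto
  have m: "U (t', x') + W (s', y') - ?P t' s' x' y' z' \<le> U (t, x) + W (s, y) - ?P t s x y z"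
    if "t' \<in> {0..T}" "s' \<in> {0..T}" "x' \<in> ?K" "y' \<in> ?K" "z' \<in> ?K" for t' s' x' y' z'
    using w(2)[of "((t', s'), x', y', z')"] that unfolding w_eq by simp
  have tx: "(t, x) \<in> cyl T Om" "(s, y) \<in> cyl T Om" "(t0, a) \<in> cyl T Om"
    using ts x y t0 a by (auto simp: cyl_def)
  define X k where "X = norm (x - y)" and "k = norm (x - a)"
  have X: "0 \<le> X" "0 \<le> k" "k \<le> r" using x by (auto simp: X_def k_def dist_norm norm_minus_commute)
  define P0 where "P0 = c * X\<^sup>2 / \<epsilon> + (t - s)\<^sup>2 / \<tau> + c * k\<^sup>2 + (t - t0)\<^sup>2"
  have terms: "0 \<le> c * X\<^sup>2 / \<epsilon>" "0 \<le> (t - s)\<^sup>2 / \<tau>" "0 \<le> c * k\<^sup>2" "0 \<le> (t - t0)\<^sup>2"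
    using D(2) \<epsilon> \<tau> by auto
  have Pge: "P0 + \<delta> * (l \<bullet> (x - a)) + \<delta> * (l \<bullet> (y - a)) \<le> ?P t s x y z"
  proof -
    have "1 / \<epsilon> * (c * X\<^sup>2) \<le> 1 / \<epsilon> * (q z (x - y) \<bullet> (x - y))"
      unfolding X_def using \<epsilon> by (intro mult_left_mono D(9)[OF z]) auto
    moreover have "c * k\<^sup>2 \<le> q a (x - a) \<bullet> (x - a)" unfolding k_def by (rule D(9)[OF aK])
    moreover have "0 \<le> 1 / \<epsilon> * ((x - z) \<bullet> (x - z))" using \<epsilon> by simp
    ultimately show ?thesis unfolding doubling_penalty_def P0_def by simp
  qed
  \<comment> \<open>The competitor is the unperturbed maximum with all space variables equal to
    \<open>a\<close>; it pays no penalty.\<close>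
  have "?P t0 t0 a a a = 0" unfolding doubling_penalty_def by (simp add: q0[OF aK])
  then have mM: "?M \<le> U (t, x) + W (s, y) - ?P t s x y z"
    using m[OF t0 t0 aK aK aK] by simp
  have lin: "\<bar>\<delta> * (l \<bullet> (v - a))\<bar> \<le> \<delta> * (C * norm (v - a))" for v
    using \<delta>(1) D(4) Cauchy_Schwarz_ineq2[of l "v - a"]
    by (simp add: abs_mult) (meson mult_right_mono norm_ge_zero order_trans)
  have lin': "\<delta> * (C * norm (v - a)) \<le> C * r" if "v \<in> ?K" for v
  proof -
    have "C * norm (v - a) \<le> C * r" using that D(3) by (intro mult_left_mono) (auto simp: dist_norm norm_minus_commute)
    moreover have "\<delta> * (C * norm (v - a)) \<le> 1 * (C * norm (v - a))" using \<delta> D(3) by (intro mult_right_mono) auto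
    ultimately show ?thesis by simp
  qed
  have "P0 \<le> B1"
    using Pge mM lin[of x] lin[of y] lin'[OF x] lin'[OF y] U(2)[OF tx(1)] U(2)[OF tx(3)] W(2)[OF tx(2)] W(2)[OF tx(3)]
    unfolding B1_def by linarith
  then have cr: "c * X\<^sup>2 / \<epsilon> < B1 + 1" "(t - s)\<^sup>2 / \<tau> < B1 + 1" using terms unfolding P0_def by linarith+
  have "X\<^sup>2 < (B1 + 1) / c * \<epsilon>" using cr(1) \<epsilon>(1) D(2) by (simp add: field_simps)
  also have "\<dots> \<le> (B1 + 1) / c * (c * \<rho>\<^sup>2 / (B1 + 1))"
    using \<epsilon>(3) \<open>0 \<le> B1\<close> D(2) by (intro mult_left_mono) auto
  also have "\<dots> = \<rho>\<^sup>2" using \<open>0 \<le> B1\<close> D(2) by simp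
  finally have X\<rho>: "X < \<rho>" using \<rho>(1) by (simp add: power_less_imp_less_base)
  have "(t - s)\<^sup>2 < (B1 + 1) * \<tau>" using cr(2) \<tau> by (simp add: field_simps)
  also have "\<dots> = \<sigma>\<^sup>2" unfolding \<tau>_def using \<open>0 \<le> B1\<close> by simp
  finally have ts\<sigma>: "\<bar>t - s\<bar> < \<sigma>" using power2_less_imp_less[of "\<bar>t - s\<bar>" \<sigma>] \<sigma>(1) by simp
  have "dist (t, x) (s, y) < d1"
    using dist_Pair_le[of t x s y] X\<rho> ts\<sigma> \<sigma>(2) \<rho>(2) unfolding X_def dist_real_def by (simp add: dist_norm)
  \<comment> \<open>Second round: the a priori bound has brought the two points together, so the
    gain over the unperturbed maximum is at most \<open>\<delta>\<^sup>2\<close>, and hence so is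
    the whole penalty.\<close>
  then have "U (t, x) + W (s, y) \<le> ?M + \<delta>\<^sup>2" by (intro d1(2) tx)
  then have lo: "P0 + \<delta> * (l \<bullet> (x - a)) + \<delta> * (l \<bullet> (y - a)) \<le> \<delta>\<^sup>2" using Pge mM by linarith
  have ya: "norm (y - a) \<le> k + X"
    using norm_triangle_ineq[of "y - x" "x - a"] unfolding k_def X_def by (simp add: norm_minus_commute)
  then have ya': "\<delta> * (C * norm (y - a)) \<le> \<delta> * (C * (k + X))"
    using \<delta>(1) D(3) by (intro mult_left_mono) auto
  have X\<delta>: "X \<le> \<delta>" using X\<rho> \<rho>(3) by simp
  then have "\<delta> * (C * X) \<le> \<delta> * (C * \<delta>)" using \<delta>(1) D(3) by (intro mult_left_mono) auto
  then have "P0 \<le> \<delta>\<^sup>2 + 2 * (\<delta> * (C * k)) + C * \<delta>\<^sup>2"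
    using lo lin[of x] lin[of y] ya' unfolding k_def[symmetric] by (simp add: algebra_simps power2_eq_square)
  \<comment> \<open>Young's inequality absorbs the linear perturbation into half of the localising
    term, leaving an error quadratic in \<open>\<delta>\<close>.\<close>
  moreover have "2 * (\<delta> * (C * k)) \<le> c * k\<^sup>2 / 2 + 2 * C\<^sup>2 / c * \<delta>\<^sup>2"
  proof -
    have "0 \<le> (c * k - 2 * C * \<delta>)\<^sup>2 / (2 * c)" using D(2) by simp
    then show ?thesis using D(2) by (simp add: power2_eq_square field_simps)
  qed
  ultimately have main: "c * X\<^sup>2 / \<epsilon> + (t - s)\<^sup>2 / \<tau> + c * k\<^sup>2 / 2 + (t - t0)\<^sup>2 \<le> C0 * \<delta>\<^sup>2"
    unfolding P0_def C0_def by (simp add: algebra_simps)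
  have XX: "X\<^sup>2 \<le> C1 * \<delta>\<^sup>2 * \<epsilon>"
  proof -
    have "c * X\<^sup>2 / \<epsilon> \<le> C0 * \<delta>\<^sup>2" using main terms by linarith
    then have "X\<^sup>2 \<le> C0 * (1 / c) * (\<delta>\<^sup>2 * \<epsilon>)" using D(2) \<epsilon>(1) by (simp add: field_simps)
    also have "\<dots> \<le> C0 * (2 / c) * (\<delta>\<^sup>2 * \<epsilon>)"
      using D(2) C0 \<epsilon>(1) by (intro mult_right_mono mult_left_mono divide_right_mono) auto
    also have "\<dots> \<le> C1 * (\<delta>\<^sup>2 * \<epsilon>)" using C1ge \<epsilon>(1) by (intro mult_right_mono) auto
    finally show ?thesis by (simp add: mult.assoc)
  qed
  have kk: "k\<^sup>2 \<le> C1 * \<delta>\<^sup>2"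
  proof -
    have "c * k\<^sup>2 / 2 \<le> C0 * \<delta>\<^sup>2" using main terms by linarith
    then have "k\<^sup>2 \<le> C0 * (2 / c) * \<delta>\<^sup>2" using D(2) by (simp add: field_simps)
    also have "\<dots> \<le> C1 * \<delta>\<^sup>2" using C1ge by (intro mult_right_mono) auto
    finally show ?thesis .
  qed
  have "(t - t0)\<^sup>2 \<le> C0 * \<delta>\<^sup>2" using main terms by linarith
  also have "\<dots> \<le> C1 * \<delta>\<^sup>2" using C1ge by (intro mult_right_mono) auto
  finally have tt: "(t - t0)\<^sup>2 \<le> C1 * \<delta>\<^sup>2" .
  have "C1 * \<delta>\<^sup>2 \<le> (C1 * \<delta>)\<^sup>2"
    using mult_right_mono[OF C1ge(3), of "C1 * \<delta>\<^sup>2"] C1ge(3)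
    unfolding power_mult_distrib power2_eq_square[of C1] by (simp only: mult_1 mult.assoc) simp
  with kk have "k\<^sup>2 \<le> (C1 * \<delta>)\<^sup>2" by linarith
  then have k1: "k \<le> C1 * \<delta>" by (rule power2_le_imp_le) (use C1ge(3) \<delta>(1) in auto)
  \<comment> \<open>Comparison with the competitor \<open>z = x\<close> changes only the matrix and
    the term in \<open>x - z\<close>. Lipschitz dependence of the matrix bounds the square of
    \<open>norm (x - z)\<close> by the same norm times \<open>C * X\<^sup>2\<close>, and one factor
    cancels.\<close>
  have zx: "norm (x - z) \<le> C * X\<^sup>2"
  proof -
    have "?P t s x y z \<le> ?P t s x y x" using m[OF ts x y x] by simp
    then have "1 / \<epsilon> * ((x - z) \<bullet> (x - z)) \<le> 1 / \<epsilon> * ((q x (x - y) - q z (x - y)) \<bullet> (x - y))"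
      unfolding doubling_penalty_def by (simp add: inner_diff_left right_diff_distrib diff_divide_distrib)
    then have "(norm (x - z))\<^sup>2 \<le> (q x (x - y) - q z (x - y)) \<bullet> (x - y)"
      using \<epsilon>(1) by (simp add: power2_norm_eq_inner divide_le_cancel)
    also have "\<dots> \<le> norm (q x (x - y) - q z (x - y)) * norm (x - y)" by (rule norm_cauchy_schwarz)
    also have "\<dots> \<le> C * norm (x - z) * norm (x - y) * norm (x - y)"
      by (intro mult_right_mono D(11)[OF x z]) auto
    finally have "norm (x - z) * norm (x - z) \<le> norm (x - z) * (C * X\<^sup>2)"
      unfolding X_def by (simp add: power2_eq_square mult_ac)
    then show ?thesis using D(3) by (cases "norm (x - z) = 0") (auto simp: mult_le_cancel_left)
  qed
  \<comment> \<open>Both points lie strictly inside the ball, so maximality on the compact set gives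
    local maxima on the cylinder.\<close>
  have "norm (y - a) < r" "k < r" using ya k1 X\<delta> \<delta> X by (auto simp: algebra_simps)
  then have dxy: "dist a x < r" "dist a y < r" unfolding k_def by (auto simp: dist_norm norm_minus_commute)
  show thesis
  proof (rule that[OF \<epsilon>(1,2) \<tau> ts x y z])
    show "\<bar>t - s\<bar> < dm \<epsilon>" "\<bar>t - s\<bar> < d0" using ts\<sigma> \<sigma> \<rho>(4) by auto
    show "norm (x - y) < d0" "norm (x - y) \<le> \<delta>" using X\<rho> \<rho>(4) X\<delta> unfolding X_def by auto
    show "(norm (x - y))\<^sup>2 \<le> C1 * \<delta>\<^sup>2 * \<epsilon>" "(norm (x - a))\<^sup>2 \<le> C1 * \<delta>\<^sup>2" "(t - t0)\<^sup>2 \<le> C1 * \<delta>\<^sup>2"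
      "norm (x - z) \<le> C * (norm (x - y))\<^sup>2"
      using XX kk tt zx unfolding X_def k_def by auto
    have "\<delta> * (C * k) + \<delta> * (C * (k + X)) \<le> \<delta> * (C * (2 * C1 * \<delta> + \<delta>))"
    proof -
      have "\<delta> * (C * (2 * k + X)) \<le> \<delta> * (C * (2 * (C1 * \<delta>) + \<delta>))"
        using k1 X\<delta> \<delta>(1) D(3) by (intro mult_left_mono add_mono) auto
      then show ?thesis by (simp add: algebra_simps)
    qed
    also have "\<dots> = \<delta> * (C * (2 * C1 + 1) * \<delta>)" by (simp add: algebra_simps)
    also have "\<dots> \<le> 1 * (C * (2 * C1 + 1) * \<delta>)"
      using \<delta> D(3) C1ge(3) by (intro mult_right_mono) auto
    finally have "\<delta> * (C * k) + \<delta> * (C * (k + X)) \<le> C * (2 * C1 + 1) * \<delta>" by simp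
    then show "U (t0, a) + W (t0, a) \<le> U (t, x) + W (s, y) + C * (2 * C1 + 1) * \<delta>"
      using mM Pge lin[of x] lin[of y] ya' terms unfolding P0_def k_def[symmetric] by linarith
    show "local_max_on (cyl T Om) (\<lambda>p. U p - ?P (fst p) s (snd p) y z) (t, x)"
    proof (rule local_max_on_cylinderI[where a = a and r = r])
      fix t' x' assume "t' \<in> {0..T}" "x' \<in> ?K"
      from m[OF this(1) ts(2) this(2) y z]
      show "U (t', x') - ?P (fst (t', x')) s (snd (t', x')) y z \<le> U (t, x) - ?P (fst (t, x)) s (snd (t, x)) y z"
        by simp
    qed (use x dxy ts in auto)
    show "local_max_on (cyl T Om) (\<lambda>p. W p - ?P t (fst p) x (snd p) z) (s, y)"
    proof (rule local_max_on_cylinderI[where a = a and r = r])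
      fix s' y' assume "s' \<in> {0..T}" "y' \<in> ?K"
      from m[OF ts(1) this(1) x this(2) z]
      show "W (s', y') - ?P t (fst (s', y')) x (snd (s', y')) z \<le> W (s, y) - ?P t (fst (s, y)) x (snd (s, y)) z"
        by simp
    qed (use y dxy ts in auto)
  qed
qed

section \<open>Strict oblique derivatives of the penalty\<close>

text \<open>The doubling form, the term in \<open>x - z\<close> and the localisation at
  \<open>a\<close> cost at most \<open>4\<close>, \<open>2\<close> and \<open>4\<close> times
  \<open>C ^ 3 * A\<close>. In the application \<open>A\<close> is
  \<open>C1 * \<delta>\<^sup>2\<close>, whereas the linear perturbation contributes at least
  \<open>c * \<delta>\<close>, so it wins for small \<open>\<delta>\<close>.\<close>

lemma penalty_gradient_fst_pos:
  assumes fr: "oblique_frame Om \<gamma> a r c C q l"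
    and x: "x \<in> frontier Om \<inter> cball a r" and y: "y \<in> closure Om \<inter> cball a r"
    and z: "z \<in> closure Om \<inter> cball a r" and a: "a \<in> closure Om"
    and "0 < \<epsilon>" "0 < \<delta>" "norm (x - y) \<le> 1"
    and X: "(norm (x - y))\<^sup>2 \<le> A * \<epsilon>" "(norm (x - a))\<^sup>2 \<le> A" "norm (x - z) \<le> C * (norm (x - y))\<^sup>2"
    and small: "10 * C ^ 3 * A < c * \<delta>"
  shows "0 < ((2 / \<epsilon>) *\<^sub>R q z (x - y) + (2 / \<epsilon>) *\<^sub>R (x - z) + 2 *\<^sub>R q a (x - a) + \<delta> *\<^sub>R l) \<bullet> \<gamma> x"
proof -
  note D = oblique_frameD[OF fr]
  have aK: "a \<in> closure Om \<inter> cball a r" using a D(1) by auto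
  have xK: "x \<in> closure Om \<inter> cball a r" using x by (auto simp: frontier_def)
  define X where "X = norm (x - y)"
  have X0: "0 \<le> X" "X \<le> 1" using assms by (auto simp: X_def)
  have "0 \<le> A" using X(2) by (meson order_trans zero_le_power2)
  have C: "C \<le> C ^ 3" "C\<^sup>2 \<le> C ^ 3" "0 \<le> C"
    using D(3) power_increasing[of 1 3 C] power_increasing[of 2 3 C] by auto
  have X\<epsilon>: "2 / \<epsilon> * X\<^sup>2 \<le> 2 * A"
    using X(1) \<open>0 < \<epsilon>\<close> unfolding X_def by (simp add: field_simps)
  have T1: "- (2 * C ^ 3 * (2 * A)) \<le> 2 / \<epsilon> * (q z (x - y) \<bullet> \<gamma> x)"
  proof -
    have "C\<^sup>2 * norm (z - x) * X \<le> C\<^sup>2 * (C * X\<^sup>2) * 1"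
      using X(3) X0 C by (intro mult_mono) (auto simp: X_def norm_minus_commute)
    then have "C * X\<^sup>2 + C\<^sup>2 * norm (z - x) * X \<le> C * X\<^sup>2 + C ^ 3 * X\<^sup>2"
      by (simp add: power2_eq_square power3_eq_cube mult_ac)
    also have "\<dots> \<le> C ^ 3 * X\<^sup>2 + C ^ 3 * X\<^sup>2" using C by (intro add_mono mult_right_mono) auto
    finally have "- (2 * C ^ 3 * X\<^sup>2) \<le> q z (x - y) \<bullet> \<gamma> x"
      using oblique_frame_inner_ge[OF fr x y z] unfolding X_def by linarith
    then have "2 / \<epsilon> * - (2 * C ^ 3 * X\<^sup>2) \<le> 2 / \<epsilon> * (q z (x - y) \<bullet> \<gamma> x)"
      using \<open>0 < \<epsilon>\<close> by (intro mult_left_mono) auto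
    moreover have "2 * C ^ 3 * (2 / \<epsilon> * X\<^sup>2) \<le> 2 * C ^ 3 * (2 * A)"
      using C X\<epsilon> by (intro mult_left_mono) auto
    ultimately show ?thesis by (simp add: mult_ac)
  qed
  have T2: "- (C ^ 3 * (2 * A)) \<le> 2 / \<epsilon> * ((x - z) \<bullet> \<gamma> x)"
  proof -
    have "\<bar>(x - z) \<bullet> \<gamma> x\<bar> \<le> norm (x - z) * norm (\<gamma> x)" by (rule Cauchy_Schwarz_ineq2)
    also have "\<dots> \<le> (C * X\<^sup>2) * C" using X(3) D(7)[OF xK] C unfolding X_def by (intro mult_mono) auto
    also have "\<dots> \<le> C ^ 3 * X\<^sup>2" using mult_right_mono[OF C(2), of "X\<^sup>2"] by (simp add: power2_eq_square mult_ac)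
    finally have "- (C ^ 3 * X\<^sup>2) \<le> (x - z) \<bullet> \<gamma> x" by linarith
    then have "2 / \<epsilon> * - (C ^ 3 * X\<^sup>2) \<le> 2 / \<epsilon> * ((x - z) \<bullet> \<gamma> x)"
      using \<open>0 < \<epsilon>\<close> by (intro mult_left_mono) auto
    moreover have "C ^ 3 * (2 / \<epsilon> * X\<^sup>2) \<le> C ^ 3 * (2 * A)"
      using C X\<epsilon> by (intro mult_left_mono) auto
    ultimately show ?thesis by (simp add: mult_ac)
  qed
  have T3: "- (2 * C ^ 3 * A) \<le> q a (x - a) \<bullet> \<gamma> x"
  proof -
    have "(C + C\<^sup>2) * (norm (x - a))\<^sup>2 \<le> (2 * C ^ 3) * A"
      using X(2) C by (intro mult_mono) auto
    moreover have "- ((C + C\<^sup>2) * (norm (x - a))\<^sup>2) \<le> q a (x - a) \<bullet> \<gamma> x"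
      using oblique_frame_inner_ge[OF fr x aK aK]
      by (simp add: norm_minus_commute power2_eq_square algebra_simps)
    ultimately show ?thesis by linarith
  qed
  have "c * \<delta> \<le> (l \<bullet> \<gamma> x) * \<delta>" using D(12)[OF x] \<open>0 < \<delta>\<close> by (intro mult_right_mono) auto
  then show ?thesis using T1 T2 T3 small by (simp add: inner_add_left mult_ac)
qed

text \<open>The boundary point is now \<open>y\<close>, while the matrix sits at \<open>z\<close>,
  which is close to \<open>x\<close>. Passing through \<open>x\<close> bounds the distance from
  \<open>z\<close> to \<open>y\<close> by \<open>2 * C\<close> times that of \<open>x\<close> and
  \<open>y\<close>, so exchanging the matrices still costs only a quadratic error.\<close>

lemma penalty_gradient_snd_pos:
  assumes fr: "oblique_frame Om \<gamma> a r c C q l"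
    and y: "y \<in> frontier Om \<inter> cball a r" and x: "x \<in> closure Om \<inter> cball a r"
    and z: "z \<in> closure Om \<inter> cball a r"
    and "0 < \<epsilon>" "0 < \<delta>" "norm (x - y) \<le> 1"
    and X: "(norm (x - y))\<^sup>2 \<le> A * \<epsilon>" "norm (x - z) \<le> C * (norm (x - y))\<^sup>2"
    and small: "10 * C ^ 3 * A < c * \<delta>"
  shows "0 < ((2 / \<epsilon>) *\<^sub>R q z (y - x) + \<delta> *\<^sub>R l) \<bullet> \<gamma> y"
proof -
  note D = oblique_frameD[OF fr]
  define X where "X = norm (x - y)"
  have X0: "0 \<le> X" "X \<le> 1" using assms by (auto simp: X_def)
  have "0 \<le> A" using X(1) \<open>0 < \<epsilon>\<close> by (smt (verit) zero_le_power2 mult_neg_pos)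
  have C: "C \<le> C ^ 3" "C\<^sup>2 \<le> C ^ 3" "0 \<le> C" "1 \<le> C"
    using D(3) power_increasing[of 1 3 C] power_increasing[of 2 3 C] by auto
  have "norm (z - y) \<le> norm (x - z) + X"
    using norm_triangle_ineq[of "z - x" "x - y"] by (simp add: X_def norm_minus_commute)
  also have "\<dots> \<le> C * X + C * X"
  proof (rule add_mono)
    have "X\<^sup>2 \<le> X" using X0 by (simp add: power2_eq_square mult_left_le_one_le)
    then have "C * X\<^sup>2 \<le> C * X" using C by (intro mult_left_mono)
    then show "norm (x - z) \<le> C * X" using X(2) by (simp add: X_def)
    show "X \<le> C * X" using X0 C(4) by (simp add: mult_le_cancel_right1)
  qed
  finally have "C\<^sup>2 * norm (z - y) * X \<le> C\<^sup>2 * (C * X + C * X) * X"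
    using X0 by (intro mult_right_mono mult_left_mono) auto
  then have "C * X\<^sup>2 + C\<^sup>2 * norm (z - y) * X \<le> C * X\<^sup>2 + 2 * C ^ 3 * X\<^sup>2"
    by (simp add: power2_eq_square power3_eq_cube algebra_simps)
  also have "\<dots> \<le> C ^ 3 * X\<^sup>2 + 2 * C ^ 3 * X\<^sup>2" using C by (intro add_mono mult_right_mono) auto
  finally have "- (3 * C ^ 3 * X\<^sup>2) \<le> q z (y - x) \<bullet> \<gamma> y"
    using oblique_frame_inner_ge[OF fr y x z] unfolding X_def norm_minus_commute[of y x] by linarith
  then have "2 / \<epsilon> * - (3 * C ^ 3 * X\<^sup>2) \<le> 2 / \<epsilon> * (q z (y - x) \<bullet> \<gamma> y)"
    using \<open>0 < \<epsilon>\<close> by (intro mult_left_mono) auto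
  moreover have "2 / \<epsilon> * X\<^sup>2 \<le> 2 * A"
    using X(1) \<open>0 < \<epsilon>\<close> unfolding X_def by (simp add: field_simps)
  then have "3 * C ^ 3 * (2 / \<epsilon> * X\<^sup>2) \<le> 3 * C ^ 3 * (2 * A)"
    using C by (intro mult_left_mono) auto
  ultimately have T: "- (6 * C ^ 3 * A) \<le> 2 / \<epsilon> * (q z (y - x) \<bullet> \<gamma> y)" by (simp add: mult_ac)
  have "0 \<le> C ^ 3 * A" using C \<open>0 \<le> A\<close> by simp
  moreover have "c * \<delta> \<le> (l \<bullet> \<gamma> y) * \<delta>" using D(12)[OF y] \<open>0 < \<delta>\<close> by (intro mult_right_mono) auto
  ultimately show ?thesis using T small by (simp add: inner_add_left mult_ac)
qed

section \<open>Estimates for the Hamiltonian\<close>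

lemma transpose_mult_bounded_bilinear:
  obtains N where "0 \<le> N" "\<And>(A :: real^'m^'n) p. norm (transpose A *v p) \<le> N * norm A * norm p"
proof -
  have "bilinear (\<lambda>(A :: real^'m^'n) p. transpose A *v p)"
    unfolding bilinear_def
    by (auto intro!: linearI simp: matrix_vector_right_distrib matrix_vector_mult_scaleR
        matrix_vector_mult_def transpose_def vec_eq_iff algebra_simps sum.distrib sum_distrib_left)
  then obtain N where "N > 0" "\<And>(A :: real^'m^'n) p. norm (transpose A *v p) \<le> N * norm A * norm p"
    using bilinear_bounded_pos by metis
  then show thesis by (intro that[of N]) auto
qed

text \<open>This is convexity of the squared norm at \<open>v / \<mu>\<close> and
  \<open>w / (1 - \<mu>)\<close> with weights \<open>\<mu>\<close> and \<open>1 - \<mu>\<close>,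
  proved through a perfect square.\<close>

lemma norm_add_power2_le:
  fixes v w :: "'a::real_inner"
  assumes "0 < \<mu>" "\<mu> < 1"
  shows "(norm (v + w))\<^sup>2 \<le> (norm v)\<^sup>2 / \<mu> + (norm w)\<^sup>2 / (1 - \<mu>)"
proof -
  have "0 \<le> ((1 - \<mu>) * norm v - \<mu> * norm w)\<^sup>2 / (\<mu> * (1 - \<mu>))" using assms by simp
  also have "\<dots> = (norm v)\<^sup>2 / \<mu> + (norm w)\<^sup>2 / (1 - \<mu>) - (norm v + norm w)\<^sup>2"
    using assms by (simp add: power2_eq_square field_simps)
  finally have "(norm v + norm w)\<^sup>2 \<le> (norm v)\<^sup>2 / \<mu> + (norm w)\<^sup>2 / (1 - \<mu>)" by simp
  moreover have "(norm (v + w))\<^sup>2 \<le> (norm v + norm w)\<^sup>2" by (intro power_mono norm_triangle_ineq) auto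
  ultimately show ?thesis by linarith
qed

text \<open>The factor \<open>1/\<mu> > 1\<close> gained by the convexity of the Hamiltonian absorbs the terms that are
  quadratic in the unbounded common gradient \<open>p\<close>.\<close>
lemma Ham_diff_le:
  fixes \<sigma> :: "real \<times> (real^'n) \<Rightarrow> real^'m^'n"
  assumes \<mu>: "0 < \<mu>" "\<mu> < 1"
    and N: "0 \<le> N" "\<And>(A :: real^'m^'n) p. norm (transpose A *v p) \<le> N * norm A * norm p"
    and S: "norm (\<sigma> (t, x)) \<le> S" "norm (\<sigma> (s, y)) \<le> S" and B: "norm (b (t, x)) \<le> B" "norm (b (s, y)) \<le> B"
    and \<sigma>: "norm (\<sigma> (s, y) - \<sigma> (t, x)) * norm p \<le> \<omega>" and b: "norm (b (t, x) - b (s, y)) * norm p \<le> \<omega>"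
    and e: "norm e \<le> \<omega>" "norm e' \<le> \<omega>"
  shows "Ham \<sigma> b s y (p + e') - \<mu> * Ham \<sigma> b t x ((1 / \<mu>) *\<^sub>R (p + e))
    \<le> (N * (1 + 2 * S) * \<omega>)\<^sup>2 / (2 * (1 - \<mu>)) + (1 + 2 * B) * \<omega>"
proof -
  define A A' where "A = transpose (\<sigma> (t, x))" and "A' = transpose (\<sigma> (s, y))"
  define w where "w = A' *v (p + e') - A *v (p + e)"
  have S0: "0 \<le> S" "0 \<le> B" using S(1) B(1) norm_ge_zero order_trans by blast+
  \<comment> \<open>In the difference of the two arguments, the large vector \<open>p\<close> meets
    only the difference of the matrices; the full matrices act only on the small errors.\<close>
  have w: "w = (transpose (\<sigma> (s, y) - \<sigma> (t, x))) *v p + A' *v e' - A *v e"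
    unfolding w_def A_def A'_def
    by (simp add: matrix_vector_right_distrib matrix_vector_mult_def transpose_def vec_eq_iff algebra_simps
        sum.distrib sum_subtractf)
  have w1: "norm (transpose (\<sigma> (s, y) - \<sigma> (t, x)) *v p) \<le> N * \<omega>"
    using order_trans[OF N(2) mult_left_mono[OF \<sigma> N(1), unfolded mult.assoc[symmetric]]] .
  have w2: "norm (A' *v e') \<le> N * S * \<omega>" "norm (A *v e) \<le> N * S * \<omega>"
  proof -
    show "norm (A' *v e') \<le> N * S * \<omega>"
      unfolding A'_def by (rule order_trans[OF N(2)]) (intro mult_mono S e N(1) mult_nonneg_nonneg S0 order_refl norm_ge_zero)
    show "norm (A *v e) \<le> N * S * \<omega>"
      unfolding A_def by (rule order_trans[OF N(2)]) (intro mult_mono S e N(1) mult_nonneg_nonneg S0 order_refl norm_ge_zero)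
  qed
  have "norm w \<le> N * \<omega> + N * S * \<omega> + N * S * \<omega>"
    unfolding w by (rule order_trans[OF norm_triangle_ineq4 add_mono[OF order_trans[OF norm_triangle_ineq add_mono[OF w1 w2(1)]] w2(2)]])
  then have "norm w \<le> N * (1 + 2 * S) * \<omega>" by (simp add: algebra_simps)
  then have w3: "(norm w)\<^sup>2 / (1 - \<mu>) \<le> (N * (1 + 2 * S) * \<omega>)\<^sup>2 / (1 - \<mu>)"
    using \<mu> by (intro divide_right_mono power_mono) auto
  have sq: "(norm (A' *v (p + e')))\<^sup>2 \<le> (norm (A *v (p + e)))\<^sup>2 / \<mu> + (norm w)\<^sup>2 / (1 - \<mu>)"
    using norm_add_power2_le[OF \<mu>, of "A *v (p + e)" w] by (simp add: w_def)
  have quad: "(norm (A' *v (p + e')))\<^sup>2 / 2 - (norm (A *v (p + e)))\<^sup>2 / (2 * \<mu>)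
      \<le> (N * (1 + 2 * S) * \<omega>)\<^sup>2 / (2 * (1 - \<mu>))"
  proof -
    have half: "X / (2 * Y) = X / Y / 2" for X Y :: real by simp
    have "X / 2 - Y / 2 \<le> V / 2" if "X \<le> Y + W" "W \<le> V" for X Y V W :: real using that by linarith
    from this[OF sq w3] show ?thesis unfolding half .
  qed
  have "b (t, x) \<bullet> (p + e) - b (s, y) \<bullet> (p + e') = (b (t, x) - b (s, y)) \<bullet> p + b (t, x) \<bullet> e - b (s, y) \<bullet> e'"
    by (simp add: algebra_simps)
  moreover have "\<bar>b (t, x) \<bullet> e\<bar> \<le> B * \<omega>" "\<bar>b (s, y) \<bullet> e'\<bar> \<le> B * \<omega>"
    using B e S0 by (auto intro!: order_trans[OF Cauchy_Schwarz_ineq2] mult_mono)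
  moreover have "\<bar>(b (t, x) - b (s, y)) \<bullet> p\<bar> \<le> \<omega>" using Cauchy_Schwarz_ineq2 b order_trans by blast
  ultimately have lin: "b (t, x) \<bullet> (p + e) - b (s, y) \<bullet> (p + e') \<le> (1 + 2 * B) * \<omega>"
    by (simp add: algebra_simps)
  have "\<mu> * Ham \<sigma> b t x ((1 / \<mu>) *\<^sub>R (p + e)) = (norm (A *v (p + e)))\<^sup>2 / (2 * \<mu>) - b (t, x) \<bullet> (p + e)"
    unfolding Ham_def A_def[symmetric] matrix_vector_mult_scaleR norm_scaleR inner_scaleR_right
    using \<mu> by (simp add: power_mult_distrib power_divide power2_eq_square[of \<mu>] right_diff_distrib)
  moreover have "Ham \<sigma> b s y (p + e') = (norm (A' *v (p + e')))\<^sup>2 / 2 - b (s, y) \<bullet> (p + e')"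
    by (simp add: Ham_def A'_def)
  ultimately show ?thesis using quad lin by linarith
qed


section \<open>Comparison\<close>

theorem mainTheorem17:
  fixes T :: real and Om :: "(real^'n) set" and nrm \<gamma> :: "real^'n \<Rightarrow> real^'n"
    and \<sigma> :: "real \<times> (real^'n) \<Rightarrow> real^'m^'n" and b :: "real \<times> (real^'n) \<Rightarrow> real^'n"
    and \<psi> u v :: "real \<times> (real^'n) \<Rightarrow> real"
  assumes T_pos: "0 < T"
    and dom: "W2inf_domain Om nrm"
    and gamma_lip: "\<exists>L. L-lipschitz_on UNIV \<gamma>"
    and gamma_obl: "\<exists>c0>0. \<forall>x\<in>frontier Om. \<gamma> x \<bullet> nrm x \<ge> c0"
    and b_cont: "continuous_on ({0..T} \<times> closure Om) b"
    and sigma_cont: "continuous_on ({0..T} \<times> closure Om) \<sigma>"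
    and b_lip: "\<exists>L. \<forall>t\<in>{0..T}. L-lipschitz_on (closure Om) (\<lambda>x. b (t,x))"
    and sigma_lip: "\<exists>L. \<forall>t\<in>{0..T}. L-lipschitz_on (closure Om) (\<lambda>x. \<sigma> (t,x))"
    and psi_cont: "continuous_on ({0..T} \<times> closure Om) \<psi>"
    and sub: "visc_sub T Om \<gamma> \<sigma> b \<psi> u"
    and super: "visc_super T Om \<gamma> \<sigma> b \<psi> v"
  shows "\<forall>t\<in>{0..T}. \<forall>x\<in>closure Om. u (t,x) \<le> v (t,x)"
proof (rule ccontr)
  assume "\<not> ?thesis"
  then obtain t1 x1 where t1: "t1 \<in> {0..T}" and x1: "x1 \<in> closure Om" and gap: "v (t1, x1) < u (t1, x1)"
    by (auto simp: not_le)
  have Om: "open Om" "bounded Om" using dom unfolding W2inf_domain_def by auto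
  have comp: "compact (cyl T Om)"
    unfolding cyl_def using Om(2) by (intro compact_Times) (auto simp: compact_closure)
  note cont = b_cont[folded cyl_def] sigma_cont[folded cyl_def] psi_cont[folded cyl_def]
  have "\<exists>B. \<forall>p \<in> cyl T Om. norm (b p) \<le> B" "\<exists>B. \<forall>p \<in> cyl T Om. norm (\<sigma> p) \<le> B" "\<exists>B. \<forall>p \<in> cyl T Om. norm (\<psi> p) \<le> B"
    using compact_imp_bounded[OF compact_continuous_image[OF cont(1) comp]]
      compact_imp_bounded[OF compact_continuous_image[OF cont(2) comp]]
      compact_imp_bounded[OF compact_continuous_image[OF cont(3) comp]] unfolding bounded_iff by auto
  moreover have "\<exists>B. \<forall>p \<in> cyl T Om. norm (u p) \<le> B" "\<exists>B. \<forall>p \<in> cyl T Om. norm (v p) \<le> B"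
    using sub super unfolding visc_sub_def visc_super_def bounded_iff by auto
  ultimately obtain B S Fp Fu Fv where B: "\<forall>p \<in> cyl T Om. norm (b p) \<le> B" and S: "\<forall>p \<in> cyl T Om. norm (\<sigma> p) \<le> S"
    and Fp: "\<forall>p \<in> cyl T Om. norm (\<psi> p) \<le> Fp" and Fu: "\<forall>p \<in> cyl T Om. norm (u p) \<le> Fu"
    and Fv: "\<forall>p \<in> cyl T Om. norm (v p) \<le> Fv"
    by blast
  have p1: "(t1, x1) \<in> cyl T Om" using t1 x1 by (auto simp: cyl_def)
  have nn: "0 \<le> B" "0 \<le> S" "0 \<le> Fp" "0 \<le> Fu" "0 \<le> Fv"
    using p1 B S Fp Fu Fv norm_ge_zero order_trans by blast+
  define F where "F = Fp + Fu + Fv"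
  have F: "\<bar>\<psi> p\<bar> \<le> F" "\<bar>u p\<bar> \<le> F" "\<bar>v p\<bar> \<le> F" if "p \<in> cyl T Om" for p
    using bspec[OF Fp that] bspec[OF Fu that] bspec[OF Fv that] nn unfolding F_def by auto
  have F0: "0 \<le> F" using nn by (simp add: F_def)
  \<comment> \<open>A third of the gap leaves room for the two perturbations: the time term costs at
    most \<open>m\<close>, and replacing \<open>u\<close> by \<open>\<mu> * u\<close> costs at most
    \<open>m / 4\<close>.\<close>
  define m where "m = (u (t1, x1) - v (t1, x1)) / 3"
  have m: "0 < m" using gap by (simp add: m_def)
  define \<kappa> where "\<kappa> = m / T"
  have \<kappa>: "0 < \<kappa>" "\<kappa> * T = m" using m T_pos by (auto simp: \<kappa>_def)
  \<comment> \<open>The bound by one half keeps \<open>\<mu>\<close> positive; the other makes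
    \<open>(1 - \<mu>) * F\<close> at most \<open>m / 4\<close>.\<close>
  define \<mu> where "\<mu> = 1 - min (1/2) (m / (4 * (F + 1)))"
  have \<mu>: "0 < \<mu>" "\<mu> < 1" using m F0 by (auto simp: \<mu>_def min_def)
  have \<mu>F: "(1 - \<mu>) * \<bar>f\<bar> \<le> m / 4" if "\<bar>f\<bar> \<le> F" for f
  proof -
    have "(1 - \<mu>) * \<bar>f\<bar> \<le> m / (4 * (F + 1)) * (F + 1)"
      using that F0 m by (intro mult_mono) (auto simp: \<mu>_def)
    also have "\<dots> = m / 4" using F0 by (simp add: field_simps)
    finally show ?thesis .
  qed
  have \<mu>F': "\<mu> * f \<le> f + m / 4" "f \<le> \<mu> * f + m / 4" if "\<bar>f\<bar> \<le> F" for f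
  proof -
    have "\<bar>(1 - \<mu>) * f\<bar> \<le> m / 4" using \<mu>F[OF that] \<mu> by (simp add: abs_mult)
    then have "\<bar>f - \<mu> * f\<bar> \<le> m / 4" by (simp only: left_diff_distrib mult_1)
    then show "\<mu> * f \<le> f + m / 4" "f \<le> \<mu> * f + m / 4" by linarith+
  qed
  \<comment> \<open>The term linear in time supplies the strict margin \<open>\<kappa>\<close> that
    contradicts the two Hamiltonian inequalities.\<close>
  define U where "U = (\<lambda>p. \<mu> * u p + - \<kappa> * (T - fst p))"
  define W where "W = (\<lambda>p. - v p)"
  have semi: "usc_on (cyl T Om) u" "lsc_on (cyl T Om) v"
    using sub super unfolding visc_sub_def visc_super_def by auto
  have U: "usc_on (cyl T Om) U"
    unfolding U_def
    by (rule usc_on_add[OF usc_on_cmult[OF semi(1) \<mu>(1)] usc_on_continuous]) (intro continuous_intros)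
  have W: "usc_on (cyl T Om) W" unfolding W_def by (rule usc_on_uminus_lsc[OF semi(2)])
  have Ub: "\<bar>U p\<bar> \<le> F + m" and Wb: "\<bar>W p\<bar> \<le> F + m" if p: "p \<in> cyl T Om" for p
  proof -
    have "\<bar>\<mu> * u p\<bar> \<le> 1 * F" unfolding abs_mult using \<mu> F(2)[OF p] F0 by (intro mult_mono) auto
    moreover have "\<kappa> * (T - fst p) \<le> \<kappa> * T" "0 \<le> \<kappa> * (T - fst p)"
      using \<kappa>(1) p by (auto simp: cyl_def)
    ultimately show "\<bar>U p\<bar> \<le> F + m" unfolding U_def \<kappa>(2) by (auto simp: abs_le_iff)
    show "\<bar>W p\<bar> \<le> F + m" unfolding W_def using F(3)[OF p] m by simp
  qed
  obtain w0 where w0: "w0 \<in> cyl T Om" "\<And>p. p \<in> cyl T Om \<Longrightarrow> U p + W p \<le> U w0 + W w0"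
    using usc_attains_max[OF comp _ usc_on_add[OF U W]] p1 by blast
  obtain t0 a where w0_eq: "w0 = (t0, a)" by (cases w0)
  have t0: "t0 \<in> {0..T}" and a: "a \<in> closure Om" using w0(1) w0_eq by (auto simp: cyl_def)
  note max = w0(2)[unfolded w0_eq]
  have M: "m \<le> U (t0, a) + W (t0, a)"
  proof -
    have "\<kappa> * (T - t1) \<le> \<kappa> * T" using \<kappa>(1) t1 by auto
    moreover have "u (t1, x1) - v (t1, x1) = 3 * m" by (simp add: m_def)
    ultimately have "m \<le> U (t1, x1) + W (t1, x1)"
      using \<mu>F'[OF F(2)[OF p1]] m unfolding U_def W_def \<kappa>(2) by simp
    then show ?thesis using max[OF p1] by linarith
  qed
  obtain L c0 where "L-lipschitz_on UNIV \<gamma>" "0 < c0" "\<And>x. x \<in> frontier Om \<Longrightarrow> c0 \<le> \<gamma> x \<bullet> nrm x"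
    using gamma_lip gamma_obl by blast
  from W2inf_domain_oblique_frame[OF dom this a]
  obtain r c C q l where fr: "oblique_frame Om \<gamma> a r c C q l" by blast
  note D = oblique_frameD[OF fr]
  \<comment> \<open>At the terminal time both solutions are separated by the obstacle, so there the
    perturbed difference is at most \<open>m / 4\<close>, below the maximum.\<close>
  have t0T: "t0 < T"
  proof (rule ccontr)
    assume "\<not> t0 < T"
    then have "t0 = T" using t0 by simp
    have "u (T, a) \<le> \<psi> (T, a)" "\<psi> (T, a) \<le> v (T, a)"
      using visc_sub_terminal_le[OF T_pos Om(2,1) a fr B cont(3) sub]
        visc_super_terminal_ge[OF T_pos Om(2,1) a fr B cont(3) super] by auto
    then show False using M \<mu>F'[OF F(2)[OF w0(1)]] m unfolding U_def W_def w0_eq \<open>t0 = T\<close>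
      by simp
  qed
  obtain Lb Ls where lip: "\<forall>t\<in>{0..T}. Lb-lipschitz_on (closure Om) (\<lambda>x. b (t,x))"
    "\<forall>t\<in>{0..T}. Ls-lipschitz_on (closure Om) (\<lambda>x. \<sigma> (t,x))" using b_lip sigma_lip by blast
  define Lx where "Lx = max Lb Ls"
  have Lip: "Lx-lipschitz_on (closure Om) (\<lambda>x. b (t,x))" "Lx-lipschitz_on (closure Om) (\<lambda>x. \<sigma> (t,x))"
    if "t \<in> {0..T}" for t
    using lipschitz_on_le[OF bspec[OF lip(1) that], of Lx] lipschitz_on_le[OF bspec[OF lip(2) that], of Lx]
    by (auto simp: Lx_def)
  have Lx0: "0 \<le> Lx" using lipschitz_on_nonneg[OF Lip(1)[OF t0]] .
  \<comment> \<open>Uniform continuity of both coefficients, with the tolerance named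
    \<open>\<epsilon>\<close> because it will be the penalty parameter itself.\<close>
  have "\<exists>d>0. \<forall>p\<in>cyl T Om. \<forall>p'\<in>cyl T Om. dist p' p < d \<longrightarrow> dist (b p') (b p) < \<epsilon> \<and> dist (\<sigma> p') (\<sigma> p) < \<epsilon>"
    if eps: "0 < \<epsilon>" for \<epsilon>
  proof -
    obtain d where "d > 0" "\<And>p p'. p \<in> cyl T Om \<Longrightarrow> p' \<in> cyl T Om \<Longrightarrow> dist p' p < d \<Longrightarrow> dist (b p') (b p) < \<epsilon>"
      by (rule uniformly_continuous_onE[OF compact_uniformly_continuous[OF cont(1) comp] eps]) blast
    moreover obtain d' where "d' > 0" "\<And>p p'. p \<in> cyl T Om \<Longrightarrow> p' \<in> cyl T Om \<Longrightarrow> dist p' p < d' \<Longrightarrow> dist (\<sigma> p') (\<sigma> p) < \<epsilon>"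
      by (rule uniformly_continuous_onE[OF compact_uniformly_continuous[OF cont(2) comp] eps]) blast
    ultimately show ?thesis by (intro exI[of _ "min d d'"]) auto
  qed
  then obtain dm where dm: "\<And>\<epsilon>. 0 < \<epsilon> \<Longrightarrow> 0 < dm \<epsilon>"
    "\<And>\<epsilon> p p'. 0 < \<epsilon> \<Longrightarrow> p \<in> cyl T Om \<Longrightarrow> p' \<in> cyl T Om \<Longrightarrow> dist p' p < dm \<epsilon> \<Longrightarrow>
      dist (b p') (b p) < \<epsilon> \<and> dist (\<sigma> p') (\<sigma> p) < \<epsilon>"
    by metis
  obtain dp where dp: "dp > 0" "\<And>p p'. p \<in> cyl T Om \<Longrightarrow> p' \<in> cyl T Om \<Longrightarrow> dist p' p < dp \<Longrightarrow> dist (\<psi> p') (\<psi> p) < m / 4"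
    using uniformly_continuous_onE[OF compact_uniformly_continuous[OF cont(3) comp], of "m / 4"] m by auto
  obtain N where N: "0 \<le> N" "\<And>(A :: real^'m^'n) p. norm (transpose A *v p) \<le> N * norm A * norm p"
    using transpose_mult_bounded_bilinear by blast
  define C1 where "C1 = (1 + C + 2 * C\<^sup>2 / c) * (1 + 2 / c)"
  have C1: "1 \<le> C1"
    unfolding C1_def using D(2,3) mult_mono[of 1 "1 + C + 2 * C\<^sup>2 / c" 1 "1 + 2 / c"] by simp
  \<comment> \<open>\<open>K * \<delta>\<close> will dominate every perturbation: the first summand
    comes from the spatial oscillation of the coefficients, the second from the gradients of the
    terms in \<open>x - z\<close> and \<open>x - a\<close>, and the last from the oscillation in
    time and from \<open>l\<close>.\<close>
  define K where "K = 2 * C * Lx * C1 + 4 * C * C1 + 2 * C"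
  have K0: "0 \<le> K" unfolding K_def using D(3) Lx0 C1 by auto
  \<comment> \<open>\<open>Z * \<delta>\<close> bounds the total error in the subtracted
    inequalities: time localisation, then the two parts of the Hamiltonian estimate.\<close>
  define Z where "Z = 2 * C1 + (N * (1 + 2 * S) * K)\<^sup>2 / (2 * (1 - \<mu>)) + (1 + 2 * B) * K"
  have small: "\<forall>\<^sub>F \<delta> in at_right 0. \<delta> * k < e" if "0 < e" for k e :: real
  proof -
    have "((\<lambda>\<delta>. \<delta> * k) \<longlongrightarrow> 0 * k) (at_right 0)" by (intro tendsto_intros)
    then show ?thesis using that by (intro order_tendstoD(2)) auto
  qed
  \<comment> \<open>In order, after positivity: \<open>\<delta>\<close> is below one, the maximum
    stays in the ball, \<open>s\<close> stays before \<open>T\<close>, the oblique derivatives are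
    strict, the loss of value is below \<open>m / 4\<close>, and the total error is below
    \<open>\<kappa>\<close>.\<close>
  have "\<forall>\<^sub>F \<delta> in at_right 0. 0 < \<delta> \<and> \<delta> * 1 < 1 \<and> \<delta> * (C1 + 1) < r \<and> \<delta> * (C1 + 1) < T - t0
      \<and> \<delta> * (10 * C ^ 3 * C1) < c \<and> \<delta> * (C * (2 * C1 + 1)) < m / 4 \<and> \<delta> * Z < \<kappa>"
    by (intro eventually_conj small) (use D m \<kappa> t0T in \<open>auto simp: eventually_at_right_less\<close>)
  then obtain \<delta> where \<delta>: "0 < \<delta>" "\<delta> < 1" "(C1 + 1) * \<delta> < r" "(C1 + 1) * \<delta> < T - t0"
    "\<delta> * (10 * C ^ 3 * C1) < c" "C * (2 * C1 + 1) * \<delta> < m / 4" "\<delta> * Z < \<kappa>"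
    using eventually_happens'[OF trivial_limit_at_right_real] by (auto simp: mult.commute)
  define d0 where "d0 = min \<delta> (dp / 2)"
  have d0: "0 < d0" "d0 \<le> \<delta>" "d0 \<le> dp / 2" using \<delta>(1) dp(1) by (auto simp: d0_def)
  obtain \<epsilon> \<tau> t s x y z where \<epsilon>: "0 < \<epsilon>" "\<epsilon> \<le> \<delta>" "0 < \<tau>" and ts: "t \<in> {0..T}" "s \<in> {0..T}"
    and x: "x \<in> closure Om \<inter> cball a r" and y: "y \<in> closure Om \<inter> cball a r" and z: "z \<in> closure Om \<inter> cball a r"
    and tsd: "\<bar>t - s\<bar> < dm \<epsilon>" "\<bar>t - s\<bar> < d0" "norm (x - y) < d0" "norm (x - y) \<le> \<delta>"
    and est: "(norm (x - y))\<^sup>2 \<le> C1 * \<delta>\<^sup>2 * \<epsilon>" "(norm (x - a))\<^sup>2 \<le> C1 * \<delta>\<^sup>2" "(t - t0)\<^sup>2 \<le> C1 * \<delta>\<^sup>2"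
      "norm (x - z) \<le> C * (norm (x - y))\<^sup>2"
    and UW: "U (t0, a) + W (t0, a) \<le> U (t, x) + W (s, y) + C * (2 * C1 + 1) * \<delta>"
    and maxU: "local_max_on (cyl T Om) (\<lambda>p. U p - doubling_penalty q l a t0 \<delta> \<epsilon> \<tau> (fst p) s (snd p) y z) (t, x)"
    and maxW: "local_max_on (cyl T Om) (\<lambda>p. W p - doubling_penalty q l a t0 \<delta> \<epsilon> \<tau> t (fst p) x (snd p) z) (s, y)"
    by (rule doubling_max[OF Om(2) a t0 fr U Ub W Wb max C1_def \<delta>(1) less_imp_le[OF \<delta>(2)] \<delta>(3) d0(1), where dm = dm])
      (use dm(1) in blast)+
  have tx: "(t, x) \<in> cyl T Om" "(s, y) \<in> cyl T Om" "(t, y) \<in> cyl T Om"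
    using ts x y by (auto simp: cyl_def)
  have aK: "a \<in> closure Om \<inter> cball a r" using a D(1) by auto
  have "C1 * \<delta>\<^sup>2 \<le> (C1 * \<delta>)\<^sup>2"
    using mult_right_mono[OF C1, of "C1 * \<delta>\<^sup>2"] C1
    unfolding power_mult_distrib power2_eq_square[of C1] by (simp only: mult_1 mult.assoc) simp
  then have "(norm (x - a))\<^sup>2 \<le> (C1 * \<delta>)\<^sup>2" "\<bar>t - t0\<bar>\<^sup>2 \<le> (C1 * \<delta>)\<^sup>2" using est(2,3) by simp_all
  moreover have C1\<delta>: "0 \<le> C1 * \<delta>" using C1 \<delta>(1) by simp
  ultimately have xa: "norm (x - a) \<le> C1 * \<delta>" and tt0: "\<bar>t - t0\<bar> \<le> C1 * \<delta>"
    using power2_le_imp_le[of "norm (x - a)" "C1 * \<delta>"] power2_le_imp_le[of "\<bar>t - t0\<bar>" "C1 * \<delta>"] by blast+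
  \<comment> \<open>The Hamiltonian inequality for the supersolution is available only before
    \<open>T\<close>; the one for the subsolution holds at every \<open>t\<close>.\<close>
  have "s < T" using \<delta>(4) tt0 tsd(2) d0(2) by (auto simp: algebra_simps abs_le_iff)
  have sgn: "10 * C ^ 3 * (C1 * \<delta>\<^sup>2) < c * \<delta>"
    using mult_strict_right_mono[OF \<delta>(5,1)] by (simp add: power2_eq_square mult_ac)
  have xy1: "norm (x - y) \<le> 1" using tsd(4) \<delta>(2) by simp
  \<comment> \<open>The two gradients share the possibly large vector \<open>p\<close> and differ
    from it by \<open>e\<close> and \<open>e'\<close>, which are of order \<open>\<delta>\<close>.
    The sign of \<open>e'\<close> comes from the negated gradient of the supersolution's test
    function.\<close>
  define p where "p = (2 / \<epsilon>) *\<^sub>R q z (x - y)"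
  define e where "e = (2 / \<epsilon>) *\<^sub>R (x - z) + 2 *\<^sub>R q a (x - a) + \<delta> *\<^sub>R l"
  define e' where "e' = - (\<delta> *\<^sub>R l)"
  define A where "A = 2 / \<tau> * (t - s)"
  let ?P1 = "\<lambda>p. doubling_penalty q l a t0 \<delta> \<epsilon> \<tau> (fst p) s (snd p) y z"
  let ?P2 = "\<lambda>p. doubling_penalty q l a t0 \<delta> \<epsilon> \<tau> t (fst p) x (snd p) z"
  \<comment> \<open>Maximality holds for \<open>\<mu> * u\<close>; dividing by \<open>\<mu>\<close>
    gives a test function for \<open>u\<close> itself.\<close>
  let ?\<phi> = "\<lambda>p. (1 / \<mu>) * (?P1 p + \<kappa> * (T - fst p))"
  define \<phi>t where "\<phi>t = (\<lambda>p :: real \<times> (real^'n). (1 / \<mu>) * ((2 / \<tau> * (fst p - s) + 2 * (fst p - t0)) + \<kappa> * (-1)))"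
  define \<phi>x where "\<phi>x = (\<lambda>p :: real \<times> (real^'n). (1 / \<mu>) *\<^sub>R (((2 / \<epsilon>) *\<^sub>R q z (snd p - y)
    + (2 / \<epsilon>) *\<^sub>R (snd p - z) + 2 *\<^sub>R q a (snd p - a) + \<delta> *\<^sub>R l) + \<kappa> *\<^sub>R 0))"
  have tfU: "test_fun ?\<phi> \<phi>t \<phi>x"
    unfolding \<phi>t_def \<phi>x_def
    by (intro test_fun_scale test_fun_add test_fun_doubling_penalty_fst test_fun_time_linear D(6)[OF z] D(8)[OF z] D(6)[OF aK] D(8)[OF aK])
  have \<phi>tx: "\<phi>t (t, x) = (1 / \<mu>) * (A + 2 * (t - t0) - \<kappa>)" "\<phi>x (t, x) = (1 / \<mu>) *\<^sub>R (p + e)"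
    unfolding \<phi>t_def \<phi>x_def A_def p_def e_def by (simp_all add: add.assoc)
  have mxU: "local_max_on (cyl T Om) (\<lambda>p. u p - ?\<phi> p) (t, x)"
  proof -
    have *: "u p - ?\<phi> p = (U p - ?P1 p) / \<mu>" for p using \<mu> by (simp add: U_def field_simps)
    show ?thesis using maxU \<mu> unfolding local_max_on_def * by (simp add: divide_le_cancel)
  qed
  have "0 < \<phi>x (t, x) \<bullet> \<gamma> x" if "x \<in> frontier Om"
  proof -
    have "0 < (p + e) \<bullet> \<gamma> x"
      unfolding p_def e_def using penalty_gradient_fst_pos[OF fr _ y z a \<epsilon>(1) \<delta>(1) xy1 est(1,2,4) sgn] that x
      by (simp add: add.assoc)
    then show ?thesis unfolding \<phi>tx using \<mu> by simp
  qed
  from visc_sub_inequality[OF sub Om(1) tfU mxU this]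
  have uH: "- ((1 / \<mu>) * (A + 2 * (t - t0) - \<kappa>)) + Ham \<sigma> b t x ((1 / \<mu>) *\<^sub>R (p + e)) \<le> 0
      \<or> u (t, x) \<le> \<psi> (t, x)"
    unfolding \<phi>tx by blast
  have tfW: "test_fun ?P2 (\<lambda>p. 2 / \<tau> * (fst p - t)) (\<lambda>p. (2 / \<epsilon>) *\<^sub>R q z (snd p - x) + \<delta> *\<^sub>R l)"
    by (intro test_fun_doubling_penalty_snd D(6)[OF z] D(8)[OF z])
  have bdW: "0 < ((2 / \<epsilon>) *\<^sub>R q z (y - x) + \<delta> *\<^sub>R l) \<bullet> \<gamma> y" if "y \<in> frontier Om"
    using penalty_gradient_snd_pos[OF fr _ x z \<epsilon>(1) \<delta>(1) xy1 est(1,4) sgn] that y by simp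
  have vs: "\<psi> (s, y) \<le> v (s, y)" "0 \<le> 2 / \<tau> * (s - t) + Ham \<sigma> b s y (- ((2 / \<epsilon>) *\<^sub>R q z (y - x) + \<delta> *\<^sub>R l))"
    using visc_super_inequality[OF super Om(1) tfW maxW[unfolded W_def]] bdW \<open>s < T\<close> by simp_all
  have "q z (y - x) = - q z (x - y)" using linear_neg[OF D(6)[OF z], of "x - y"] by simp
  then have "- ((2 / \<epsilon>) *\<^sub>R q z (y - x) + \<delta> *\<^sub>R l) = p + e'" unfolding p_def e'_def by simp
  moreover have "2 / \<tau> * (s - t) = - A" unfolding A_def mult_minus_right[symmetric] by simp
  ultimately have vH: "A \<le> Ham \<sigma> b s y (p + e')" using vs(2) by simp
  consider "- ((1 / \<mu>) * (A + 2 * (t - t0) - \<kappa>)) + Ham \<sigma> b t x ((1 / \<mu>) *\<^sub>R (p + e)) \<le> 0"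
    | "u (t, x) \<le> \<psi> (t, x)"
    using uH by blast
  then show False
  proof cases
    \<comment> \<open>Subtracting the two Hamiltonian inequalities cancels the time derivative
      \<open>A\<close> of the doubling term and leaves \<open>\<kappa>\<close> bounded by the
      errors.\<close>
    case 1
    have "\<mu> * H \<le> R" if "- ((1 / \<mu>) * R) + H \<le> 0" for H R
      using that \<mu> by (simp add: field_simps)
    from this[OF 1] have "\<mu> * Ham \<sigma> b t x ((1 / \<mu>) *\<^sub>R (p + e)) \<le> A + 2 * (t - t0) - \<kappa>" .
    then have H1: "\<kappa> \<le> 2 * (t - t0) + (Ham \<sigma> b s y (p + e') - \<mu> * Ham \<sigma> b t x ((1 / \<mu>) *\<^sub>R (p + e)))"
      using vH by linarith
    have H2: "Ham \<sigma> b s y (p + e') - \<mu> * Ham \<sigma> b t x ((1 / \<mu>) *\<^sub>R (p + e))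
        \<le> (N * (1 + 2 * S) * (K * \<delta>))\<^sup>2 / (2 * (1 - \<mu>)) + (1 + 2 * B) * (K * \<delta>)"
    proof (rule Ham_diff_le[OF \<mu> N])
      show "norm (\<sigma> (t, x)) \<le> S" "norm (\<sigma> (s, y)) \<le> S" "norm (b (t, x)) \<le> B" "norm (b (s, y)) \<le> B"
        using B S tx by auto
      let ?X = "norm (x - y)"
      have pn: "norm p \<le> 2 / \<epsilon> * (C * ?X)" unfolding p_def using D(10)[OF z, of "x - y"] \<epsilon>(1)
        by (auto intro!: divide_right_mono mult_left_mono)
      have "2 / \<epsilon> * ?X\<^sup>2 \<le> 2 * (C1 * \<delta>\<^sup>2)" using est(1) \<epsilon>(1) by (simp add: field_simps)
      moreover have "\<delta>\<^sup>2 \<le> \<delta>" using \<delta>(1,2) by (simp add: power2_eq_square mult_left_le_one_le)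
      then have "2 * (C1 * \<delta>\<^sup>2) \<le> 2 * (C1 * \<delta>)" using C1 by (intro mult_left_mono) auto
      ultimately have X2: "2 / \<epsilon> * ?X\<^sup>2 \<le> 2 * (C1 * \<delta>)" by linarith
      \<comment> \<open>As \<open>p\<close> grows like \<open>norm (x - y) / \<epsilon>\<close>, the
        spatial oscillation produces the square of the distance over \<open>\<epsilon>\<close>,
        which is small by \<open>est\<close>; an oscillation in time of size
        \<open>\<epsilon>\<close> cancels the denominator.\<close>
      have osc: "d * norm p \<le> K * \<delta>" if "0 \<le> d" "d \<le> Lx * ?X + \<epsilon>" for d
      proof -
        have "d * norm p \<le> (Lx * ?X + \<epsilon>) * (2 / \<epsilon> * (C * ?X))" using that pn by (intro mult_mono) auto
        also have "\<dots> = Lx * C * (2 / \<epsilon> * ?X\<^sup>2) + 2 * C * ?X"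
          using \<epsilon>(1) by (simp add: field_simps power2_eq_square)
        also have "\<dots> \<le> Lx * C * (2 * (C1 * \<delta>)) + 2 * C * \<delta>"
          using X2 tsd(4) Lx0 D(3) by (intro add_mono mult_left_mono) auto
        also have "\<dots> \<le> Lx * C * (2 * (C1 * \<delta>)) + 2 * C * \<delta> + 4 * C * (C1 * \<delta>)"
          using D(3) C1\<delta> by simp
        also have "\<dots> = K * \<delta>" unfolding K_def by (simp add: algebra_simps)
        finally show ?thesis .
      qed
      have dty: "dist (s, y) (t, y) < dm \<epsilon>" using dist_Pair_le[of s y t y] tsd(1) by (simp add: dist_real_def abs_minus_commute)
      have "norm (\<sigma> (s, y) - \<sigma> (t, y)) < \<epsilon>" "norm (b (s, y) - b (t, y)) < \<epsilon>"
        using dm(2)[OF \<epsilon>(1) tx(3,2) dty] by (auto simp: dist_norm)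
      moreover have "norm (\<sigma> (t, y) - \<sigma> (t, x)) \<le> Lx * ?X" "norm (b (t, y) - b (t, x)) \<le> Lx * ?X"
        using lipschitz_onD[OF Lip(2)[OF ts(1)], of y x] lipschitz_onD[OF Lip(1)[OF ts(1)], of y x] x y
        by (auto simp: dist_norm norm_minus_commute)
      ultimately have "norm (\<sigma> (s, y) - \<sigma> (t, x)) \<le> Lx * ?X + \<epsilon>" "norm (b (t, x) - b (s, y)) \<le> Lx * ?X + \<epsilon>"
        using norm_triangle_ineq[of "\<sigma> (s, y) - \<sigma> (t, y)" "\<sigma> (t, y) - \<sigma> (t, x)"]
          norm_triangle_ineq[of "b (s, y) - b (t, y)" "b (t, y) - b (t, x)"] norm_minus_commute[of "b (t, x)" "b (s, y)"]
        by auto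
      then show "norm (\<sigma> (s, y) - \<sigma> (t, x)) * norm p \<le> K * \<delta>" "norm (b (t, x) - b (s, y)) * norm p \<le> K * \<delta>"
        by (auto intro!: osc)
      have "norm ((2 / \<epsilon>) *\<^sub>R (x - z)) \<le> C * (2 * (C1 * \<delta>))"
      proof -
        have "2 / \<epsilon> * norm (x - z) \<le> 2 / \<epsilon> * (C * ?X\<^sup>2)" using est(4) \<epsilon>(1) by (intro mult_left_mono) auto
        also have "\<dots> = C * (2 / \<epsilon> * ?X\<^sup>2)" by simp
        also have "\<dots> \<le> C * (2 * (C1 * \<delta>))" using X2 D(3) by (intro mult_left_mono) auto
        finally show ?thesis using \<epsilon>(1) by simp
      qed
      moreover have "norm (2 *\<^sub>R q a (x - a)) \<le> 2 * (C * (C1 * \<delta>))"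
      proof -
        have "C * norm (x - a) \<le> C * (C1 * \<delta>)" using xa D(3) by (intro mult_left_mono) auto
        then show ?thesis using D(10)[OF aK, of "x - a"] by simp
      qed
      moreover have l: "norm (\<delta> *\<^sub>R l) \<le> C * \<delta>" using D(4) \<delta>(1) by simp
      ultimately have "norm e \<le> C * (2 * (C1 * \<delta>)) + 2 * (C * (C1 * \<delta>)) + C * \<delta>"
        unfolding e_def by (intro norm_triangle_le add_mono)
      also have "\<dots> \<le> 4 * C * C1 * \<delta> + 2 * C * \<delta>" using D(3) \<delta>(1) by (simp add: algebra_simps)
      also have "\<dots> \<le> K * \<delta>" unfolding K_def using D(3) \<delta>(1) Lx0 C1 by (simp add: algebra_simps)
      finally show "norm e \<le> K * \<delta>" .
      have "C * \<delta> \<le> K * \<delta>" unfolding K_def using D(3) \<delta>(1) Lx0 C1 by (intro mult_right_mono) auto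
      with l show "norm e' \<le> K * \<delta>" unfolding e'_def norm_minus_cancel by linarith
    qed
    \<comment> \<open>Since \<open>\<delta> < 1\<close>, one of its two powers may be dropped, so
      that all errors become linear in \<open>\<delta>\<close>.\<close>
    have H3: "(N * (1 + 2 * S) * (K * \<delta>))\<^sup>2 / (2 * (1 - \<mu>)) \<le> (N * (1 + 2 * S) * K)\<^sup>2 / (2 * (1 - \<mu>)) * \<delta>"
    proof -
      have "(N * (1 + 2 * S) * (K * \<delta>))\<^sup>2 / (2 * (1 - \<mu>)) = (N * (1 + 2 * S) * K)\<^sup>2 / (2 * (1 - \<mu>)) * \<delta>\<^sup>2"
        by (simp add: power_mult_distrib)
      also have "\<dots> \<le> (N * (1 + 2 * S) * K)\<^sup>2 / (2 * (1 - \<mu>)) * \<delta>"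
        using \<delta>(1,2) \<mu> by (intro mult_left_mono) (auto simp: power2_eq_square mult_left_le_one_le)
      finally show ?thesis .
    qed
    have "\<kappa> \<le> 2 * (C1 * \<delta>) + (N * (1 + 2 * S) * K)\<^sup>2 / (2 * (1 - \<mu>)) * \<delta> + (1 + 2 * B) * (K * \<delta>)"
    proof -
      have "k \<le> 2 * h' + X' + Y"
        if "k \<le> 2 * h + H" "H \<le> X + Y" "X \<le> X'" "\<bar>h\<bar> \<le> h'" for k h h' H X X' Y :: real
        using that by linarith
      from this[OF H1 H2 H3 tt0] show ?thesis .
    qed
    also have "\<dots> = \<delta> * Z" unfolding Z_def by (simp add: algebra_simps)
    finally show False using \<delta>(7) by simp
  next
    case 2
    \<comment> \<open>Here the obstacle lies between the solutions: the factor \<open>\<mu>\<close>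
      and the oscillation of \<open>\<psi>\<close> each cost \<open>m / 4\<close>, so the perturbed
      difference is below \<open>m / 2\<close>, while near-maximality keeps it above
      \<open>3 * m / 4\<close>.\<close>
    have "dist (t, x) (s, y) < dp"
      using dist_Pair_le[of t x s y] tsd d0(3) by (simp add: dist_norm)
    then have "\<psi> (t, x) - \<psi> (s, y) < m / 4" using dp(2)[OF tx(2,1)] unfolding dist_real_def by linarith
    moreover have "\<mu> * u (t, x) \<le> \<mu> * \<psi> (t, x)" using 2 \<mu> by simp
    moreover have "0 \<le> \<kappa> * (T - t)" using \<kappa> ts by simp
    ultimately have "U (t, x) + W (s, y) < m / 2"
      using \<mu>F'[OF F(1)[OF tx(1)]] vs(1) unfolding U_def W_def by simp
    then show False using UW M \<delta>(6) m by linarith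
  qed
qed

end
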